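(* Let $r\ge2$, let $G$ be a group with center $Z(G)$, and let $\omega\colon G^r\to G$. (i) If $\omega(x_1,\ldots,x_r)=c\,x_1\cdots x_r$ with $c\in Z(G)$, then $\mathrm{Assoc}_r(\omega)=F_r$. (ii) If $\omega(x_1,\ldots,x_r)=a\,x_1\cdots x_r$ with $a\in G\setminus Z(G)$ and the order $k$ of $aZ(G)$ in $G/Z(G)$ is finite, then $\mathrm{Assoc}_r(\omega)=\iota_{V^L_{r,k}}(F_{1+k(r-1)})$; if that order is infinite, then $\mathrm{Assoc}_r(\omega)=1$. (iii) If $\omega(x_1,\ldots,x_r)=x_1\cdots x_r\,b$ with $b\in G\setminus Z(G)$ and the order $k$ of $bZ(G)$ in $G/Z(G)$ is finite, then $\mathrm{Assoc}_r(\omega)=\iota_{V^R_{r,k}}(F_{1+k(r-1)})$; if that order is infinite, then $\mathrm{Assoc}_r(\omega)=1$. (iv) If $\omega(x_1,\ldots,x_r)=d\,\psi(x_1\cdots x_r)$ with $d\in Z(G)$, $\psi\in\mathrm{Aut}(G)$ and the order $h$ of $\psi$ in $\mathrm{Aut}(G)$ is finite, then $\mathrm{Assoc}_r(\omega)=\iota_{P_{r,h}}(F_{r^h})$; if $\psi$ has infinite order, then $\mathrm{Assoc}_r(\omega)=1$.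
   Context: A full ordered $r$-ary tree is either a single leaf or a root with an ordered $r$-tuple of full ordered $r$-ary subtrees. For an operation $q\colon Q^r\to Q$ and such a tree $T$ with $n$ leaves, $q_T\colon Q^n\to Q$ is obtained by placing the variables at the leaves from left to right and applying $q$ at every internal vertex. Higman–Thompson group $F_r$: its elements are represented by pairs $(T,U)$ of full ordered $r$-ary trees with the same number of leaves, modulo the equivalence relation generated by simultaneous expansion, i.e. replacing the $i$th leaf of both $T$ and $U$ by a caret (an internal vertex with $r$ leaf children). To compose $(T,U)$ with $(U',V)$, expand both pairs simultaneously until the middle trees $U$ and $U'$ become the same tree and take the pair of outer trees; the identity is represented by $(T,T)$ and the inverse of $(T,U)$ by $(U,T)$. $\mathrm{Assoc}_r(q)\le F_r$ is the subgroup of elements having a representative $(T,U)$ with $q_T=q_U$. For a full ordered $r$-ary tree $C$ with $m\ge2$ leaves, $\iota_C\colon F_m\hookrightarrow F_r$ is the embedding induced on tree pairs by replacing every internal vertex of an $m$-ary tree by a copy of $C$, the $m$ leaves of $C$ (left to right) serving as attachment points for the $m$ children (in order). The right vine $V^R_{r,k}$ has $k$ internal vertices in one chain starting at the root, in which the rightmost child of each internal vertex except the last is the next internal vertex and all other children are leaves; $V^L_{r,k}$ is its mirror image. Both have $1+k(r-1)$ leaves. $P_{r,h}$ is the perfect $r$-ary tree of height $h$ (all leaves at depth $h$), with $r^h$ leaves. *)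

theory Defs
  imports "HOL-Algebra.Algebra" "HOL-Library.NList"
begin

section \<open>Full ordered trees\<close>

datatype otree = Leaf | Node "otree list"

primrec full :: "nat \<Rightarrow> otree \<Rightarrow> bool" where
  "full r Leaf \<longleftrightarrow> True"
| "full r (Node ts) \<longleftrightarrow> length ts = r \<and> list_all (full r) ts"

primrec leaves :: "otree \<Rightarrow> nat" where
  "leaves Leaf = 1"
| "leaves (Node ts) = sum_list (map leaves ts)"

text \<open>\<open>tree_op q T xs\<close> is $q_T(x_1,\ldots,x_n)$, meant for \<open>length xs = leaves T\<close>;
  operations of arity \<open>r\<close> are functions on lists, used on lists of length \<open>r\<close>.\<close>

fun tree_op :: "('a list \<Rightarrow> 'a) \<Rightarrow> otree \<Rightarrow> 'a list \<Rightarrow> 'a"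
  and forest_op :: "('a list \<Rightarrow> 'a) \<Rightarrow> otree list \<Rightarrow> 'a list \<Rightarrow> 'a list" where
  "tree_op q Leaf xs = hd xs"
| "tree_op q (Node ts) xs = q (forest_op q ts xs)"
| "forest_op q [] xs = []"
| "forest_op q (t # ts) xs =
     tree_op q t (take (leaves t) xs) # forest_op q ts (drop (leaves t) xs)"

text \<open>\<open>expand r i T\<close> replaces the leaf number \<open>i\<close> of \<open>T\<close> (counted from left to right, starting
  with 0) by an \<open>r\<close>-ary caret, for \<open>i < leaves T\<close>.\<close>

fun expand :: "nat \<Rightarrow> nat \<Rightarrow> otree \<Rightarrow> otree"
  and expand_forest :: "nat \<Rightarrow> nat \<Rightarrow> otree list \<Rightarrow> otree list" where
  "expand r i Leaf = Node (replicate r Leaf)"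
| "expand r i (Node ts) = Node (expand_forest r i ts)"
| "expand_forest r i [] = []"
| "expand_forest r i (t # ts) =
     (if i < leaves t then expand r i t # ts else t # expand_forest r (i - leaves t) ts)"

primrec left_vine :: "nat \<Rightarrow> nat \<Rightarrow> otree" where
  "left_vine r 0 = Leaf"
| "left_vine r (Suc k) = Node (left_vine r k # replicate (r - 1) Leaf)"

primrec right_vine :: "nat \<Rightarrow> nat \<Rightarrow> otree" where
  "right_vine r 0 = Leaf"
| "right_vine r (Suc k) = Node (replicate (r - 1) Leaf @ [right_vine r k])"

primrec perfect :: "nat \<Rightarrow> nat \<Rightarrow> otree" where
  "perfect r 0 = Leaf"
| "perfect r (Suc h) = Node (replicate r (perfect r h))"

section \<open>Higman--Thompson groups\<close>

definition tree_pairs :: "nat \<Rightarrow> (otree \<times> otree) set" where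
  "tree_pairs r = {(T, U). full r T \<and> full r U \<and> leaves T = leaves U}"

definition expansion :: "nat \<Rightarrow> ((otree \<times> otree) \<times> (otree \<times> otree)) set" where
  "expansion r =
     {((T, U), (expand r i T, expand r i U)) | T U i. (T, U) \<in> tree_pairs r \<and> i < leaves T}"

text \<open>The equivalence relation on tree pairs generated by simultaneous expansion.\<close>

definition pair_rel :: "nat \<Rightarrow> ((otree \<times> otree) \<times> (otree \<times> otree)) set" where
  "pair_rel r = (expansion r \<union> (expansion r)\<inverse>)\<^sup>* \<inter> (tree_pairs r \<times> tree_pairs r)"

text \<open>An element of the group is a class of tree pairs. Such a class is itself a relation between
  trees, and \<open>A O B\<close> consists of the pairs \<open>(T, V)\<close> with \<open>(T, U) \<in> A\<close> and \<open>(U, V) \<in> B\<close> for a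
  common middle tree \<open>U\<close>. These pairs need not exhaust a class, whence the saturation.\<close>

definition HT :: "nat \<Rightarrow> (otree \<times> otree) set monoid" where
  "HT r = \<lparr>carrier = tree_pairs r // pair_rel r,
           monoid.mult = (\<lambda>A B. pair_rel r `` (A O B)),
           one = pair_rel r `` {(Leaf, Leaf)}\<rparr>"

text \<open>\<open>Assoc r Q q\<close>, for an operation \<open>q\<close> of arity \<open>r\<close> on the set \<open>Q\<close>; here \<open>nlists n Q\<close> is the
  set of \<open>n\<close>-tuples.\<close>

definition Assoc :: "nat \<Rightarrow> 'a set \<Rightarrow> ('a list \<Rightarrow> 'a) \<Rightarrow> (otree \<times> otree) set set" where
  "Assoc r Q q = {A \<in> carrier (HT r).
     \<exists>(T, U) \<in> A. \<forall>xs \<in> nlists (leaves T) Q. tree_op q T xs = tree_op q U xs}"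

text \<open>\<open>tree_op Node C\<close> evaluates \<open>C\<close> in the algebra of trees: it attaches the given trees to the
  leaves of \<open>C\<close> from left to right.\<close>

primrec subst_tree :: "otree \<Rightarrow> otree \<Rightarrow> otree" where
  "subst_tree C Leaf = Leaf"
| "subst_tree C (Node ts) = tree_op Node C (map (subst_tree C) ts)"

text \<open>\<open>iota r C\<close> sends the class of \<open>(T, U)\<close> in \<open>HT (leaves C)\<close> to the class in \<open>HT r\<close> of the
  substituted pair.\<close>

definition iota :: "nat \<Rightarrow> otree \<Rightarrow> (otree \<times> otree) set \<Rightarrow> (otree \<times> otree) set" where
  "iota r C A = pair_rel r `` (map_prod (subst_tree C) (subst_tree C) ` A)"

section \<open>Groups\<close>

definition center :: "('a, 'b) monoid_scheme \<Rightarrow> 'a set" where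
  "center G = {z \<in> carrier G. \<forall>g \<in> carrier G. z \<otimes>\<^bsub>G\<^esub> g = g \<otimes>\<^bsub>G\<^esub> z}"

definition list_prod :: "('a, 'b) monoid_scheme \<Rightarrow> 'a list \<Rightarrow> 'a" where
  "list_prod G xs = foldr (\<otimes>\<^bsub>G\<^esub>) xs \<one>\<^bsub>G\<^esub>"

text \<open>The order of $a Z(G)$ in $G/Z(G)$. As always for \<^const>\<open>group.ord\<close>, the value 0 stands for
  infinite order.\<close>

definition ord_mod_center :: "('a, 'b) monoid_scheme \<Rightarrow> 'a \<Rightarrow> nat" where
  "ord_mod_center G a = group.ord (G Mod center G) (center G #>\<^bsub>G\<^esub> a)"

end

theory Submission
  imports Defs
begin

text \<open>
  In the cases of a noncentral factor \<open>a\<close> on the left, of a noncentral factor \<open>b\<close> on the right, and of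
  an automorphism \<open>\<psi>\<close>, let \<open>\<phi> d\<close> be the map \<open>x \<mapsto> a\<^sup>d x\<close>, \<open>x \<mapsto> x b\<^sup>d\<close> or \<open>\<psi>\<^sup>d\<close>. Multiplying out the
  operation along a tree \<open>T\<close> gives \<open>z \<cdot> \<phi> \<lambda>\<^sub>1 x\<^sub>1 \<cdots> \<phi> \<lambda>\<^sub>n x\<^sub>n\<close> with a central \<open>z\<close>, where the label \<open>\<lambda>\<^sub>i\<close>
  depends only on the path from the root to the leaf \<open>i\<close>: it is the length of the longest final
  stretch of this path that runs through marked children only, and the marked children of a vertex
  are the leftmost one, the rightmost one, or all of them.
  This is the lemma \<open>twist_tree_op\<close>. Let \<open>k\<close> be the order of \<open>a\<close> or \<open>b\<close> modulo the center or the order of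
  \<open>\<psi>\<close>, and 0 if it is infinite. Feeding in tuples that are 1 in most places shows that two trees
  with the same operation have labels congruent modulo \<open>k\<close> (\<open>tree_op_eq_imp_labels_mod\<close>).

  Let \<open>k > 0\<close>, and let \<open>C\<close> be the vine or perfect tree of height \<open>k\<close>. If the labels of \<open>T\<close> and \<open>U\<close> are
  congruent modulo \<open>k\<close>, then one and the same family of trees, grafted onto the leaves of both, turns
  all labels into multiples of \<open>k\<close>; grafting the same trees does not change the class of the pair
  (\<open>pair_rel_graft\<close>), and a tree whose labels are multiples of \<open>k\<close> arises by substituting \<open>C\<close> for the
  vertices of a tree (\<open>multiples_labels_imp_subst_tree\<close>). Hence the class lies in the image of \<open>\<iota>\<^sub>C\<close>.
  Conversely \<open>C\<close> itself has labels 0 and \<open>k\<close> only, \<open>\<phi> 0\<close> is the identity and \<open>\<phi> k\<close> is multiplication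
  by a central element, so \<open>C\<close> evaluates to a central constant times the product of its arguments. For an operation of this
  form the value on a tree depends only on the number of leaves
  (\<open>tree_op_central_product_eq\<close>), which also settles the case of a central factor.

  Let \<open>k = 0\<close>. Then the labels of \<open>T\<close> and \<open>U\<close> are equal, and \<open>T = U\<close> because the label sequences form
  a prefix-free or suffix-free code for trees (\<open>labels_inj\<close>).
\<close>

section \<open>Grafting trees onto leaves\<close>

abbreviation graft :: "otree \<Rightarrow> otree list \<Rightarrow> otree" where
  "graft \<equiv> tree_op Node"

abbreviation graft_forest :: "otree list \<Rightarrow> otree list \<Rightarrow> otree list" where
  "graft_forest \<equiv> forest_op Node"

text \<open>Mutual induction on a tree and a list of trees, in the form that matches functions such as
  \<^const>\<open>tree_op\<close> and \<^const>\<open>forest_op\<close>.\<close>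

lemma tree_forest_induct [case_names Leaf Node Nil Cons]:
  assumes "P Leaf" and "\<And>ts. Q ts \<Longrightarrow> P (Node ts)"
    and "Q []" and "\<And>t ts. P t \<Longrightarrow> Q ts \<Longrightarrow> Q (t # ts)"
  shows "P T" and "Q ts"
proof -
  have Q: "(\<And>t. t \<in> set ts \<Longrightarrow> P t) \<Longrightarrow> Q ts" for ts
    by (induction ts) (auto intro: assms)
  show P: "P T" for T
    by (induction T) (auto intro: assms Q)
  show "Q ts"
    by (rule Q) (rule P)
qed

lemma length_forest_op [simp]: "length (forest_op q ts xs) = length ts"
  by (induction ts arbitrary: xs) auto

lemma forest_op_append:
  "forest_op q (ts @ us) xs =
     forest_op q ts (take (sum_list (map leaves ts)) xs) @
     forest_op q us (drop (sum_list (map leaves ts)) xs)"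
  by (induction ts arbitrary: xs) (auto simp: take_drop add.commute min_def)

lemma forest_op_Leaves: "length xs = n \<Longrightarrow> forest_op q (replicate n Leaf) xs = xs"
  by (induction n arbitrary: xs) (auto simp: length_Suc_conv)

lemma forest_op_take:
  "forest_op q (take n ts) (take (sum_list (map leaves (take n ts))) xs) = take n (forest_op q ts xs)"
  using forest_op_append[of q "take n ts" "drop n ts" xs]
  by (cases "n \<le> length ts") auto

lemma forest_op_drop:
  "forest_op q (drop n ts) (drop (sum_list (map leaves (take n ts))) xs) = drop n (forest_op q ts xs)"
  using forest_op_append[of q "take n ts" "drop n ts" xs]
  by (cases "n \<le> length ts") auto

lemma
  shows leaves_graft: "length Ss = leaves T \<Longrightarrow> leaves (graft T Ss) = sum_list (map leaves Ss)"
    and leaves_graft_forest: "length Ss = sum_list (map leaves ts) \<Longrightarrow>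
      sum_list (map leaves (graft_forest ts Ss)) = sum_list (map leaves Ss)"
proof (induction T and ts arbitrary: Ss and Ss rule: tree_forest_induct)
  case (Cons t ts)
  have "sum_list (map leaves Ss) =
      sum_list (map leaves (take (leaves t) Ss)) + sum_list (map leaves (drop (leaves t) Ss))"
    by (metis append_take_drop_id map_append sum_list_append)
  with Cons show ?case by simp
qed (auto simp: length_Suc_conv)

text \<open>Grafting is evaluation in the algebra of trees, so this is the associativity of
  substitution. Both expansion and \<^const>\<open>subst_tree\<close> are instances of grafting, and their evaluation
  rules follow from this lemma.\<close>

lemma
  shows tree_op_graft: "length Ss = leaves T \<Longrightarrow> length xs = sum_list (map leaves Ss) \<Longrightarrow>
      tree_op q (graft T Ss) xs = tree_op q T (forest_op q Ss xs)"
    and forest_op_graft_forest: "length Ss = sum_list (map leaves ts) \<Longrightarrow>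
      length xs = sum_list (map leaves Ss) \<Longrightarrow>
      forest_op q (graft_forest ts Ss) xs = forest_op q ts (forest_op q Ss xs)"
proof (induction T and ts arbitrary: Ss xs and Ss xs rule: tree_forest_induct)
  case (Cons t ts)
  have "leaves (graft t (take (leaves t) Ss)) = sum_list (map leaves (take (leaves t) Ss))"
    using Cons.prems by (intro leaves_graft) simp
  moreover have "sum_list (map leaves Ss) =
      sum_list (map leaves (take (leaves t) Ss)) + sum_list (map leaves (drop (leaves t) Ss))"
    by (metis append_take_drop_id map_append sum_list_append)
  ultimately show ?case
    using Cons by (simp add: forest_op_take forest_op_drop)
qed (auto simp: length_Suc_conv)

lemma
  shows full_graft: "full r T \<Longrightarrow> \<forall>S\<in>set Ss. full r S \<Longrightarrow> length Ss = leaves T \<Longrightarrow> full r (graft T Ss)"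
    and full_graft_forest: "\<forall>t\<in>set ts. full r t \<Longrightarrow> \<forall>S\<in>set Ss. full r S \<Longrightarrow>
      length Ss = sum_list (map leaves ts) \<Longrightarrow> \<forall>t\<in>set (graft_forest ts Ss). full r t"
proof (induction T and ts arbitrary: Ss and Ss rule: tree_forest_induct)
  case (Cons t ts)
  have "\<forall>S\<in>set (take (leaves t) Ss). full r S" "\<forall>S\<in>set (drop (leaves t) Ss). full r S"
    using Cons.prems(2) by (meson in_set_takeD in_set_dropD)+
  moreover have "length (take (leaves t) Ss) = leaves t"
    "length (drop (leaves t) Ss) = sum_list (map leaves ts)"
    using Cons.prems(3) by simp_all
  ultimately have "full r (graft t (take (leaves t) Ss))"
    "\<forall>t\<in>set (graft_forest ts (drop (leaves t) Ss)). full r t"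
    using Cons.IH Cons.prems(1) by (meson list.set_intros)+
  then show ?case by simp
next
  case (Node ts)
  then have "\<forall>t\<in>set (graft_forest ts Ss). full r t"
    by (intro Node.IH) (auto simp: list_all_iff)
  with Node.prems(1) show ?case by (simp add: list_all_iff)
qed (simp_all add: length_Suc_conv, fastforce)

lemma
  shows leaves_pos: "full r T \<Longrightarrow> r \<ge> 1 \<Longrightarrow> leaves T \<ge> 1"
    and leaves_forest_ge_length: "\<forall>t\<in>set ts. full r t \<Longrightarrow> r \<ge> 1 \<Longrightarrow> sum_list (map leaves ts) \<ge> length ts"
proof (induction T and ts rule: tree_forest_induct)
  case (Node ts)
  then have "sum_list (map leaves ts) \<ge> length ts" "length ts = r"
    by (simp_all add: list_all_iff)
  with Node.prems show ?case by simp
next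
  case (Cons t ts)
  then have "leaves t \<ge> 1" "sum_list (map leaves ts) \<ge> length ts"
    by simp_all
  then show ?case by simp
qed simp_all

section \<open>Expansion and substitution as grafting\<close>

lemma graft_Leaves: "graft T (replicate (leaves T) Leaf) = T"
  and graft_forest_Leaves: "graft_forest ts (replicate (sum_list (map leaves ts)) Leaf) = ts"
  by (induction T and ts rule: tree_forest_induct) auto

lemma
  shows expand_eq_graft: "i < leaves T \<Longrightarrow> expand r i T =
      graft T ((replicate (leaves T) Leaf)[i := Node (replicate r Leaf)])"
    and expand_forest_eq_graft: "i < sum_list (map leaves ts) \<Longrightarrow> expand_forest r i ts =
      graft_forest ts ((replicate (sum_list (map leaves ts)) Leaf)[i := Node (replicate r Leaf)])"
proof (induction T and ts arbitrary: i and i rule: tree_forest_induct)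
  case (Cons t ts)
  then show ?case
    by (auto simp: take_update_swap drop_update_swap graft_Leaves graft_forest_Leaves list_update_beyond)
qed auto

lemma tree_op_expand:
  assumes "length xs + length zs + 1 = leaves T" and "length ys = r"
  shows "tree_op q (expand r (length xs) T) (xs @ ys @ zs) = tree_op q T (xs @ q ys # zs)"
proof -
  have *: "(replicate (leaves T) Leaf)[length xs := Node (replicate r Leaf)] =
      replicate (length xs) Leaf @ Node (replicate r Leaf) # replicate (length zs) Leaf"
    using assms(1) by (subst list_eq_iff_nth_eq) (auto simp: nth_append nth_list_update nth_Cons')
  have "tree_op q (expand r (length xs) T) (xs @ ys @ zs) =
     tree_op q T (forest_op q (replicate (length xs) Leaf @ Node (replicate r Leaf) # replicate (length zs) Leaf) (xs @ ys @ zs))"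
    using assms by (subst expand_eq_graft) (auto simp: * tree_op_graft sum_list_replicate)
  also have "\<dots> = tree_op q T (xs @ q ys # zs)"
    using assms(2) by (simp add: forest_op_append forest_op_Leaves sum_list_replicate)
  finally show ?thesis .
qed

lemma
  shows leaves_subst_tree [simp]: "full (leaves C) T \<Longrightarrow> leaves (subst_tree C T) = leaves T"
    and "\<forall>t\<in>set ts. full (leaves C) t \<Longrightarrow>
      sum_list (map (leaves \<circ> subst_tree C) ts) = sum_list (map leaves ts)"
proof (induction T and ts rule: tree_forest_induct)
  case (Node ts)
  then show ?case
    using leaves_graft[of "map (subst_tree C) ts" C] by (simp add: list_all_iff o_def)
qed simp_all

lemma
  shows full_subst_tree: "full r C \<Longrightarrow> full (leaves C) T \<Longrightarrow> full r (subst_tree C T)"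
    and "full r C \<Longrightarrow> \<forall>t\<in>set ts. full (leaves C) t \<Longrightarrow> \<forall>t\<in>set ts. full r (subst_tree C t)"
  by (induction T and ts rule: tree_forest_induct) (auto simp: list_all_iff intro!: full_graft)

text \<open>The operation \<open>q\<^sub>C\<close> turns a \<open>q\<close>-algebra into an algebra for trees whose arity is the number
  of leaves of \<open>C\<close>; evaluating there amounts to substituting \<open>C\<close> first.\<close>

lemma
  shows tree_op_subst_tree: "full (leaves C) T \<Longrightarrow> length xs = leaves T \<Longrightarrow>
      tree_op q (subst_tree C T) xs = tree_op (tree_op q C) T xs"
    and "\<forall>t\<in>set ts. full (leaves C) t \<Longrightarrow> length xs = sum_list (map leaves ts) \<Longrightarrow>
      forest_op q (map (subst_tree C) ts) xs = forest_op (tree_op q C) ts xs"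
proof (induction T and ts arbitrary: xs and xs rule: tree_forest_induct)
  case (Node ts)
  moreover have "sum_list (map (leaves \<circ> subst_tree C) ts) = sum_list (map leaves ts)"
    using Node.prems by (intro arg_cong[where f = sum_list] map_cong) (auto simp: list_all_iff)
  ultimately show ?case by (simp add: list_all_iff tree_op_graft)
qed (auto simp: leaves_subst_tree)

text \<open>A caret at a leaf becomes a copy of \<open>C\<close> at that leaf. The proof computes in the algebra of
  trees with the operation \<open>graft C\<close>, where substitution is evaluation at leaves.\<close>

lemma subst_tree_expand:
  assumes T: "full (leaves C) T" and i: "i < leaves T" and full: "full (leaves C) (expand (leaves C) i T)"
  shows "subst_tree C (expand (leaves C) i T) = graft (subst_tree C T) ((replicate (leaves T) Leaf)[i := C])"
proof -
  let ?m = "leaves C" and ?q = "tree_op Node C"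
  define as bs cs where "as = replicate i Leaf" and "bs = replicate ?m Leaf"
    and "cs = replicate (leaves T - i - 1) Leaf"
  have leaves: "leaves (expand ?m i T) = length as + ?m + length cs"
    using i by (subst expand_eq_graft)
      (auto simp: leaves_graft map_update sum_list_update as_def cs_def sum_list_replicate)
  have "subst_tree C (expand ?m i T) = graft (subst_tree C (expand ?m i T)) (as @ bs @ cs)"
    by (metis graft_Leaves leaves leaves_subst_tree[OF full] as_def bs_def cs_def length_replicate replicate_add append_assoc)
  also have "\<dots> = tree_op ?q (expand ?m (length as) T) (as @ bs @ cs)"
    using full leaves by (simp add: tree_op_subst_tree as_def bs_def)
  also have "\<dots> = tree_op ?q T (as @ ?q bs # cs)"
    using i by (intro tree_op_expand) (auto simp: as_def bs_def cs_def)
  also have "as @ ?q bs # cs = (replicate (leaves T) Leaf)[i := C]"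
    using i by (subst list_eq_iff_nth_eq)
      (auto simp: as_def bs_def cs_def graft_Leaves nth_append nth_list_update nth_Cons')
  also have "tree_op ?q T \<dots> = graft (subst_tree C T) \<dots>"
    using T by (simp add: tree_op_subst_tree)
  finally show ?thesis .
qed

section \<open>The classes of tree pairs\<close>

lemma leaves_expand: "i < leaves T \<Longrightarrow> leaves (expand r i T) = leaves T + r - 1"
  by (subst expand_eq_graft) (auto simp: leaves_graft map_update sum_list_update sum_list_replicate)

lemma full_expand: "full r T \<Longrightarrow> i < leaves T \<Longrightarrow> full r (expand r i T)"
  using set_update_subset_insert[of "replicate (leaves T) Leaf" i "Node (replicate r Leaf)"]
  by (subst expand_eq_graft) (auto intro!: full_graft simp: list_all_iff)

lemma expansion_tree_pairs: "(P, P') \<in> expansion r \<Longrightarrow> P \<in> tree_pairs r \<and> P' \<in> tree_pairs r"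
  by (auto simp: expansion_def tree_pairs_def leaves_expand full_expand)

lemma equiv_pair_rel: "equiv (tree_pairs r) (pair_rel r)"
proof (rule equivI)
  let ?E = "expansion r \<union> (expansion r)\<inverse>"
  show "pair_rel r \<subseteq> tree_pairs r \<times> tree_pairs r"
    by (auto simp: pair_rel_def)
  show "refl_on (tree_pairs r) (pair_rel r)"
    by (auto simp: refl_on_def pair_rel_def)
  show "sym (pair_rel r)"
    unfolding pair_rel_def by (intro sym_Int sym_rtrancl sym_Un_converse) (auto simp: sym_def)
  show "trans (pair_rel r)"
    unfolding pair_rel_def by (intro trans_Int trans_rtrancl) (auto simp: trans_def)
qed

lemma expansion_imp_pair_rel: "(P, P') \<in> expansion r \<Longrightarrow> (P, P') \<in> pair_rel r"
  using expansion_tree_pairs by (auto simp: pair_rel_def)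

text \<open>Expansion adds a single caret to both trees. Grafting an arbitrary family is a sequence of
  expansions: a nontrivial member of the family is traded for a caret and its subtrees. This
  lengthens the family while its total number of leaves stays fixed, so the process ends.\<close>

lemma pair_rel_graft:
  assumes "r \<ge> 2" and "(T, U) \<in> tree_pairs r"
    and "length Ss = leaves T" and "\<forall>S\<in>set Ss. full r S"
  shows "((T, U), (graft T Ss, graft U Ss)) \<in> pair_rel r"
  using assms(2-)
proof (induction "sum_list (map leaves Ss) - length Ss" arbitrary: T U Ss rule: less_induct)
  case less
  have TU: "full r T" "full r U" "leaves T = leaves U"
    using less.prems by (auto simp: tree_pairs_def)
  show ?case
  proof (cases "\<forall>S\<in>set Ss. S = Leaf")
    case True
    then have "Ss = replicate (leaves T) Leaf"
      using less.prems by (metis replicate_length_same)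
    then have "graft T Ss = T" "graft U Ss = U"
      using TU(3) by (metis graft_Leaves)+
    then show ?thesis
      using less.prems equiv_pair_rel[of r] by (auto simp: equiv_def refl_on_def)
  next
    case False
    then obtain as ss bs where Ss: "Ss = as @ Node ss # bs"
      by (metis otree.exhaust split_list)
    have ss: "length ss = r" "\<forall>s\<in>set ss. full r s"
      using less.prems Ss by (auto simp: list_all_iff)
    define Ss' where "Ss' = as @ ss @ bs"
    have i: "length as < leaves T"
      using less.prems Ss by auto
    have graft: "graft (expand r (length as) T) Ss' = graft T Ss"
        "graft (expand r (length as) U) Ss' = graft U Ss"
      using less.prems TU Ss ss(1) by (auto simp: Ss'_def intro!: tree_op_expand)
    have exp: "((T, U), (expand r (length as) T, expand r (length as) U)) \<in> expansion r"
      using less.prems i by (auto simp: expansion_def)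
    have "sum_list (map leaves Ss') \<ge> length Ss'"
      using ss less.prems Ss \<open>r \<ge> 2\<close> by (intro leaves_forest_ge_length[of _ r]) (auto simp: Ss'_def)
    then have "sum_list (map leaves Ss') - length Ss' < sum_list (map leaves Ss) - length Ss"
      using ss \<open>r \<ge> 2\<close> by (simp add: Ss Ss'_def)
    moreover have "length Ss' = leaves (expand r (length as) T)"
      using less.prems(2) ss(1) i \<open>r \<ge> 2\<close> by (simp add: Ss Ss'_def leaves_expand)
    moreover have "\<forall>S\<in>set Ss'. full r S"
      using less.prems(3) ss(2) by (auto simp: Ss Ss'_def)
    ultimately have "((expand r (length as) T, expand r (length as) U),
        (graft (expand r (length as) T) Ss', graft (expand r (length as) U) Ss')) \<in> pair_rel r"
      using less.hyps expansion_tree_pairs[OF exp] by blast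
    then have "((expand r (length as) T, expand r (length as) U), (graft T Ss, graft U Ss)) \<in> pair_rel r"
      by (simp only: graft)
    with expansion_imp_pair_rel[OF exp] show ?thesis
      using equiv_pair_rel[of r] by (meson equiv_def transD)
  qed
qed

text \<open>An expansion step at a leaf becomes a grafting of \<open>C\<close> at that leaf on both sides, so
  substitution is well defined on classes.\<close>

lemma pair_rel_subst_tree:
  assumes r: "r \<ge> 2" and C: "full r C"
    and rel: "(P, P') \<in> pair_rel (leaves C)"
  shows "(map_prod (subst_tree C) (subst_tree C) P, map_prod (subst_tree C) (subst_tree C) P') \<in> pair_rel r"
proof -
  let ?m = "leaves C" and ?f = "map_prod (subst_tree C) (subst_tree C)"
  have tp: "?f P \<in> tree_pairs r" if "P \<in> tree_pairs ?m" for P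
    using that C by (auto simp: tree_pairs_def full_subst_tree leaves_subst_tree)
  have expansion_step: "(?f P, ?f P') \<in> pair_rel r" if PP': "(P, P') \<in> expansion ?m" for P P'
  proof -
    from PP' obtain T U i where P: "P = (T, U)" "P' = (expand ?m i T, expand ?m i U)"
      "(T, U) \<in> tree_pairs ?m" "i < leaves T"
      by (auto simp: expansion_def)
    let ?Ss = "(replicate (leaves T) Leaf)[i := C]"
    have "(?f P, (graft (subst_tree C T) ?Ss, graft (subst_tree C U) ?Ss)) \<in> pair_rel r"
      unfolding P(1) map_prod_simp
    proof (rule pair_rel_graft[OF r])
      show "(subst_tree C T, subst_tree C U) \<in> tree_pairs r"
        using tp[OF P(3)] by simp
      show "length ?Ss = leaves (subst_tree C T)"
        using P(3) by (simp add: tree_pairs_def)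
      show "\<forall>S\<in>set ?Ss. full r S"
        using set_update_subset_insert[of "replicate (leaves T) Leaf" i C] C by auto
    qed
    then show ?thesis
      using P expansion_tree_pairs[OF PP'] by (simp add: subst_tree_expand tree_pairs_def)
  qed
  have "(P, P') \<in> (expansion ?m \<union> (expansion ?m)\<inverse>)\<^sup>*" "P \<in> tree_pairs ?m"
    using rel by (auto simp: pair_rel_def)
  then show ?thesis
  proof (induction rule: rtrancl_induct)
    case base
    then show ?case
      using tp equiv_pair_rel[of r] by (auto simp: equiv_def refl_on_def)
  next
    case (step y z)
    then have "(?f y, ?f z) \<in> pair_rel r"
      using expansion_step[of y z] expansion_step[of z y] equiv_pair_rel[of r]
      by (metis UnE converseD equivE symD)
    with step show ?case
      using equiv_pair_rel[of r] by (meson equiv_def transD)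
  qed
qed

definition pair_class :: "nat \<Rightarrow> otree \<Rightarrow> otree \<Rightarrow> (otree \<times> otree) set" where
  "pair_class r T U = pair_rel r `` {(T, U)}"

lemma carrier_HT: "carrier (HT r) = {pair_class r T U | T U. (T, U) \<in> tree_pairs r}"
  by (auto simp: HT_def quotient_def pair_class_def)

lemma pair_class_self: "(T, U) \<in> tree_pairs r \<Longrightarrow> (T, U) \<in> pair_class r T U"
  unfolding pair_class_def using equiv_class_self[OF equiv_pair_rel] by simp

lemma pair_class_eq: "((T, U), (T', U')) \<in> pair_rel r \<Longrightarrow> pair_class r T U = pair_class r T' U'"
  unfolding pair_class_def by (rule equiv_class_eq[OF equiv_pair_rel])

lemma carrier_HT_rep:
  assumes "A \<in> carrier (HT r)" and "(T, U) \<in> A"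
  shows "A = pair_class r T U" and "(T, U) \<in> tree_pairs r"
proof -
  obtain T' U' where A: "A = pair_class r T' U'"
    using assms by (auto simp: carrier_HT)
  with assms(2) have rel: "((T', U'), (T, U)) \<in> pair_rel r"
    by (simp add: pair_class_def)
  then show "A = pair_class r T U" using A pair_class_eq by simp
  show "(T, U) \<in> tree_pairs r" using rel by (simp add: pair_rel_def)
qed

lemma one_HT: "\<one>\<^bsub>HT r\<^esub> = pair_class r Leaf Leaf"
  by (simp add: HT_def pair_class_def)

lemma pair_class_diag:
  assumes "r \<ge> 2" and "full r T"
  shows "pair_class r T T = \<one>\<^bsub>HT r\<^esub>"
  using pair_class_eq[OF pair_rel_graft[of r Leaf Leaf "[T]"]] assms
  by (simp add: one_HT tree_pairs_def)

lemma iota_pair_class: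
  assumes "r \<ge> 2" and "full r C" and "(T, U) \<in> tree_pairs (leaves C)"
  shows "iota r C (pair_class (leaves C) T U) = pair_class r (subst_tree C T) (subst_tree C U)"
    (is "?L = ?R")
proof -
  let ?f = "map_prod (subst_tree C) (subst_tree C)"
  have same: "pair_rel r `` {?f P} = ?R" if "P \<in> pair_class (leaves C) T U" for P
  proof -
    have "((T, U), P) \<in> pair_rel (leaves C)"
      using that by (simp only: pair_class_def Image_singleton_iff)
    from equiv_class_eq[OF equiv_pair_rel pair_rel_subst_tree[OF assms(1,2) this]]
    show ?thesis by (simp only: pair_class_def map_prod_simp)
  qed
  have "?L = (\<Union>P\<in>pair_class (leaves C) T U. pair_rel r `` {?f P})"
    unfolding iota_def by (subst Image_eq_UN) (simp only: UN_simps)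
  also have "\<dots> = (\<Union>P\<in>pair_class (leaves C) T U. ?R)"
    using same by (rule SUP_cong[OF refl])
  also have "\<dots> = ?R"
    using pair_class_self[OF assms(3)] by blast
  finally show ?thesis .
qed

section \<open>Leaf labels\<close>

text \<open>The list \<open>\<mu>\<close> has one entry for each child of a vertex and says which children are marked.
  Passing to a marked child adds 1 to the current label, and passing to an unmarked child resets
  it to 0; the start value \<open>d\<close> is the label of the root. For \<open>d = 0\<close> and all children marked, the
  label of a leaf is its depth; with only the leftmost child marked, it is the number of internal
  vertices that have this leaf as their leftmost leaf.\<close>

fun labels :: "bool list \<Rightarrow> nat \<Rightarrow> otree \<Rightarrow> nat list"
  and forest_labels :: "bool list \<Rightarrow> nat list \<Rightarrow> otree list \<Rightarrow> nat list" where
  "labels \<mu> d Leaf = [d]"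
| "labels \<mu> d (Node ts) = forest_labels \<mu> (map (\<lambda>m. if m then Suc d else 0) \<mu>) ts"
| "forest_labels \<mu> (e # es) (t # ts) = labels \<mu> e t @ forest_labels \<mu> es ts"
| "forest_labels \<mu> [] ts = []"
| "forest_labels \<mu> es [] = []"

text \<open>The marked children are expanded up to height \<open>k\<close> and the unmarked children are leaves. Left
  vines, right vines and perfect trees are the instances for the three choices of marks.\<close>

primrec chain_tree :: "bool list \<Rightarrow> nat \<Rightarrow> otree" where
  "chain_tree \<mu> 0 = Leaf"
| "chain_tree \<mu> (Suc k) = Node (map (\<lambda>m. if m then chain_tree \<mu> k else Leaf) \<mu>)"

lemma forest_labels_Nil [simp]: "forest_labels \<mu> es [] = []"
  by (cases es) auto

lemma
  shows length_labels: "full (length \<mu>) T \<Longrightarrow> length (labels \<mu> d T) = leaves T"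
    and length_forest_labels: "\<forall>t\<in>set ts. full (length \<mu>) t \<Longrightarrow> length es = length ts \<Longrightarrow>
      length (forest_labels \<mu> es ts) = sum_list (map leaves ts)"
  by (induction T and ts arbitrary: d and es rule: tree_forest_induct)
     (auto simp: list_all_iff length_Suc_conv)

lemma forest_labels_append:
  "length es = length ts \<Longrightarrow>
     forest_labels \<mu> (es @ es') (ts @ ts') = forest_labels \<mu> es ts @ forest_labels \<mu> es' ts'"
  by (induction es ts rule: list_induct2) auto

text \<open>The label of a leaf is the start value for the tree grafted onto it.\<close>

lemma
  shows labels_graft: "full (length \<mu>) T \<Longrightarrow> length Ss = leaves T \<Longrightarrow>
      labels \<mu> d (graft T Ss) = forest_labels \<mu> (labels \<mu> d T) Ss"
    and forest_labels_graft_forest: "\<forall>t\<in>set ts. full (length \<mu>) t \<Longrightarrow> length es = length ts \<Longrightarrow>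
      length Ss = sum_list (map leaves ts) \<Longrightarrow>
      forest_labels \<mu> es (graft_forest ts Ss) = forest_labels \<mu> (forest_labels \<mu> es ts) Ss"
proof (induction T and ts arbitrary: d Ss and es Ss rule: tree_forest_induct)
  case Leaf
  then show ?case by (auto simp: length_Suc_conv)
next
  case (Node ts)
  then show ?case by (simp add: list_all_iff)
next
  case Nil
  then show ?case by simp
next
  case (Cons t ts)
  obtain e es' where es: "es = e # es'" and len: "length es' = length ts"
    using Cons.prems(2) by (auto simp: length_Suc_conv)
  have "forest_labels \<mu> (labels \<mu> e t @ forest_labels \<mu> es' ts) (take (leaves t) Ss @ drop (leaves t) Ss) =
      forest_labels \<mu> (labels \<mu> e t) (take (leaves t) Ss) @
      forest_labels \<mu> (forest_labels \<mu> es' ts) (drop (leaves t) Ss)"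
    using Cons.prems by (intro forest_labels_append) (simp add: length_labels)
  then show ?case
    using Cons.prems by (simp add: es len Cons.IH)
qed

text \<open>The path to a leaf of the chain tree either follows marked children all the way, which
  raises the start value by \<open>k\<close>, or ends in an unmarked child, which resets the label.\<close>

lemma labels_chain_tree: "e \<in> set (labels \<mu> d (chain_tree \<mu> k)) \<Longrightarrow> e = 0 \<or> e = d + k"
proof (induction k arbitrary: d e)
  case (Suc k)
  have "e \<in> set (forest_labels \<mu> (map (\<lambda>m. if m then Suc d else 0) \<nu>)
      (map (\<lambda>m. if m then chain_tree \<mu> k else Leaf) \<nu>)) \<Longrightarrow> e = 0 \<or> e = d + Suc k" for \<nu>
    by (induction \<nu>) (auto split: if_splits dest: Suc.IH)
  with Suc.prems show ?case by simp
qed simp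

lemma full_chain_tree: "full (length \<mu>) (chain_tree \<mu> k)"
  by (induction k) (auto simp: list_all_iff)

section \<open>Divisibility by a chain tree\<close>

abbreviation multiples :: "nat \<Rightarrow> nat list \<Rightarrow> bool" where
  "multiples k xs \<equiv> \<forall>x\<in>set xs. k dvd x"

text \<open>Along marked children the start value is only carried over, and elsewhere it is forgotten,
  so it matters only modulo \<open>k\<close>.\<close>

lemma
  shows multiples_labels_add: "multiples k (labels \<mu> (d + k) T) = multiples k (labels \<mu> d T)"
    and multiples_forest_labels_add: "list_all2 (\<lambda>a b. a = b \<or> a = b + k) es es' \<Longrightarrow>
       multiples k (forest_labels \<mu> es ts) = multiples k (forest_labels \<mu> es' ts)"
proof (induction T and ts arbitrary: d and es es' rule: tree_forest_induct)
  case (Node ts)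
  show ?case by (simp, rule Node) (simp add: list_all2_conv_all_nth)
next
  case (Cons t ts)
  show ?case
  proof (cases es)
    case es: (Cons e es1)
    obtain e' es1' where es': "es' = e' # es1'" "e = e' \<or> e = e' + k"
        "list_all2 (\<lambda>a b. a = b \<or> a = b + k) es1 es1'"
      using Cons.prems es by (auto simp: list_all2_Cons1)
    have "multiples k (labels \<mu> e t) = multiples k (labels \<mu> e' t)"
      using es'(2) Cons.IH(1) by auto
    moreover have "multiples k (forest_labels \<mu> es1 ts) = multiples k (forest_labels \<mu> es1' ts)"
      using es'(3) by (rule Cons.IH(2))
    ultimately show ?thesis
      by (simp add: es es'(1) ball_Un)
  qed (use Cons.prems in auto)
qed auto

text \<open>The trees left over are no larger than the whole, so chain trees can be split off repeatedly
  by induction on the size.\<close>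

lemma size_graft:
  shows "length Ss = leaves T \<Longrightarrow> S \<in> set Ss \<Longrightarrow> size S \<le> size (graft T Ss)"
    and "length Ss = sum_list (map leaves ts) \<Longrightarrow> S \<in> set Ss \<Longrightarrow> size S \<le> size_list size (graft_forest ts Ss)"
proof (induction T and ts arbitrary: Ss and Ss rule: tree_forest_induct)
  case (Cons t ts)
  from Cons.prems(2) consider "S \<in> set (take (leaves t) Ss)" | "S \<in> set (drop (leaves t) Ss)"
    by (metis Un_iff append_take_drop_id set_append)
  then show ?case
  proof cases
    case 1
    then have "size S \<le> size (graft t (take (leaves t) Ss))"
      using Cons.prems by (intro Cons.IH) auto
    then show ?thesis by simp
  next
    case 2
    then have "size S \<le> size_list size (graft_forest ts (drop (leaves t) Ss))"
      using Cons.prems by (intro Cons.IH) auto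
    then show ?thesis by simp
  qed
next
  case (Node ts)
  then show ?case by (simp add: le_SucI)
qed (auto simp: length_Suc_conv)

text \<open>The trees that remain after splitting off \<open>C\<close> are labelled from the start value 0 even where
  they hang below marked children: the label reached there is \<open>k\<close>, and by \<open>multiples_labels_add\<close>
  it may be replaced by 0.\<close>

definition divisible_by :: "nat \<Rightarrow> bool list \<Rightarrow> otree \<Rightarrow> otree \<Rightarrow> bool" where
  "divisible_by k \<mu> C T \<longleftrightarrow> (\<exists>Ss. length Ss = leaves C \<and>
     (\<forall>S\<in>set Ss. full (length \<mu>) S \<and> multiples k (labels \<mu> 0 S)) \<and> T = graft C Ss)"

text \<open>One vertex of the chain. The start value at its marked children is \<open>Suc d\<close>; the lemma serves
  both the vertices with \<open>0 < d < k\<close> and the root with \<open>d = 0\<close>, which the next lemma has to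
  exclude because a root with label 0 may be a leaf.\<close>

lemma divisible_by_Node:
  assumes children: "\<And>t. full (length \<mu>) t \<Longrightarrow> multiples k (labels \<mu> (Suc d) t) \<Longrightarrow>
      divisible_by k \<mu> (chain_tree \<mu> j) t"
    and T: "full (length \<mu>) (Node ts)" "multiples k (labels \<mu> d (Node ts))"
  shows "divisible_by k \<mu> (chain_tree \<mu> (Suc j)) (Node ts)"
proof -
  let ?C = "\<lambda>\<nu>. map (\<lambda>m. if m then chain_tree \<mu> j else Leaf) \<nu>"
  have "length ts = length \<nu> \<Longrightarrow> \<forall>t\<in>set ts. full (length \<mu>) t \<Longrightarrow>
     multiples k (forest_labels \<mu> (map (\<lambda>m. if m then Suc d else 0) \<nu>) ts) \<Longrightarrow>
     \<exists>Ss. length Ss = sum_list (map leaves (?C \<nu>)) \<and>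
       (\<forall>S\<in>set Ss. full (length \<mu>) S \<and> multiples k (labels \<mu> 0 S)) \<and>
       ts = graft_forest (?C \<nu>) Ss" for ts \<nu>
  proof (induction ts \<nu> rule: list_induct2)
    case (Cons t ts m \<nu>)
    then obtain Ss where Ss: "length Ss = sum_list (map leaves (?C \<nu>))"
      "\<forall>S\<in>set Ss. full (length \<mu>) S \<and> multiples k (labels \<mu> 0 S)"
      "ts = graft_forest (?C \<nu>) Ss" by auto
    have "divisible_by k \<mu> (if m then chain_tree \<mu> j else Leaf) t"
    proof (cases m)
      case True
      then show ?thesis using Cons.prems children by auto
    next
      case False
      then show ?thesis
        unfolding divisible_by_def using Cons.prems by (intro exI[of _ "[t]"]) auto
    qed
    then obtain Ss' where Ss': "length Ss' = leaves (if m then chain_tree \<mu> j else Leaf)"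
      "\<forall>S\<in>set Ss'. full (length \<mu>) S \<and> multiples k (labels \<mu> 0 S)"
      "t = graft (if m then chain_tree \<mu> j else Leaf) Ss'"
      unfolding divisible_by_def by blast
    have "length (Ss' @ Ss) = sum_list (map leaves (?C (m # \<nu>)))"
      by (simp add: Ss(1) Ss'(1))
    moreover have "t # ts = graft_forest (?C (m # \<nu>)) (Ss' @ Ss)"
      by (simp add: Ss(3) Ss'(1,3))
    ultimately show ?case
      using Ss(2) Ss'(2) by (intro exI[of _ "Ss' @ Ss"]) auto
  qed simp
  from this[of ts \<mu>] T show ?thesis
    by (simp add: divisible_by_def list_all_iff)
qed

text \<open>A start value \<open>d\<close> strictly between 0 and \<open>k\<close> is not a multiple of \<open>k\<close>, so the tree cannot
  end at its root; it continues along marked children until the label \<open>k\<close> is reached. Hence it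
  contains the chain tree of the remaining height \<open>k - d\<close>.\<close>

lemma multiples_labels_imp_divisible_by:
  assumes "0 < d" "d \<le> k" "full (length \<mu>) T" "multiples k (labels \<mu> d T)"
  shows "divisible_by k \<mu> (chain_tree \<mu> (k - d)) T"
  using assms
proof (induction "k - d" arbitrary: d T)
  case 0
  then have "multiples k (labels \<mu> 0 T)"
    using multiples_labels_add[where d = 0 and k = k and \<mu> = \<mu> and T = T] by simp
  with 0 show ?case
    unfolding divisible_by_def by (intro exI[of _ "[T]"]) auto
next
  case (Suc j)
  obtain ts where T: "T = Node ts"
    using Suc by (cases T) (auto dest: dvd_imp_le)
  have "j = k - Suc d" "Suc d \<le> k"
    using Suc.hyps(2) by auto
  then have "divisible_by k \<mu> (chain_tree \<mu> j) t"
    if "full (length \<mu>) t" "multiples k (labels \<mu> (Suc d) t)" for t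
    using Suc.hyps(1)[of "Suc d" t] that by simp
  from divisible_by_Node[OF this, of d ts] show ?case
    using Suc.prems T Suc.hyps(2) by (metis)
qed

text \<open>At an internal root the marked children start with label 1, so a full chain tree of height
  \<open>k\<close> can be split off, and the remaining subtrees are smaller.\<close>

lemma multiples_labels_imp_subst_tree:
  assumes "k > 0" and "full (length \<mu>) T" and "multiples k (labels \<mu> 0 T)"
  shows "\<exists>T'. full (leaves (chain_tree \<mu> k)) T' \<and> T = subst_tree (chain_tree \<mu> k) T'"
  using assms(2-)
proof (induction "size T" arbitrary: T rule: less_induct)
  case less
  obtain j where k: "k = Suc j" using assms(1) by (cases k) auto
  show ?case
  proof (cases T)
    case Leaf
    then show ?thesis by (intro exI[of _ Leaf]) simp
  next
    case (Node ts)
    have "divisible_by k \<mu> (chain_tree \<mu> (Suc j)) (Node ts)"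
    proof (rule divisible_by_Node)
      show "divisible_by k \<mu> (chain_tree \<mu> j) t"
        if "full (length \<mu>) t" "multiples k (labels \<mu> (Suc 0) t)" for t
        using multiples_labels_imp_divisible_by[of "Suc 0" k \<mu> t] that k by simp
    qed (use less.prems Node in auto)
    then obtain Ss where Ss: "length Ss = leaves (chain_tree \<mu> k)"
      "\<forall>S\<in>set Ss. full (length \<mu>) S \<and> multiples k (labels \<mu> 0 S)" "Node ts = graft (chain_tree \<mu> k) Ss"
      unfolding divisible_by_def k by blast
    have "\<exists>S'. full (leaves (chain_tree \<mu> k)) S' \<and> S = subst_tree (chain_tree \<mu> k) S'" if "S \<in> set Ss" for S
    proof (rule less.hyps)
      show "size S < size T"
        using size_graft(2)[OF _ that, of "map (\<lambda>m. if m then chain_tree \<mu> j else Leaf) \<mu>"]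
          Node Ss(1,3) k by simp
    qed (use that Ss in auto)
    then obtain f where f: "full (leaves (chain_tree \<mu> k)) (f S)"
      "S = subst_tree (chain_tree \<mu> k) (f S)" if "S \<in> set Ss" for S
      by metis
    have "map (subst_tree (chain_tree \<mu> k)) (map f Ss) = Ss"
      using f(2) by (simp add: map_idI)
    then have "T = subst_tree (chain_tree \<mu> k) (Node (map f Ss))"
      using Node Ss(3) k by simp
    moreover have "full (leaves (chain_tree \<mu> k)) (Node (map f Ss))"
      using f(1) Ss(1) k by (simp add: list_all_iff)
    ultimately show ?thesis by blast
  qed
qed

section \<open>Labels determine the tree\<close>

text \<open>If the first child is marked, the first leaf of a tree has at least the label of its root,
  and strictly more if the root is internal. So the first label decides whether the tree is a
  leaf, and the label sequence can be parsed from left to right. If the last child is marked, the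
  same holds from right to left.\<close>

lemma labels_first_marked:
  assumes "full (length (True # \<mu>)) T"
  shows "\<exists>e es. labels (True # \<mu>) d T = e # es \<and> d \<le> e"
  using assms
proof (induction T arbitrary: d)
  case (Node ts)
  then obtain u us where ts: "ts = u # us" by (cases ts) auto
  with Node.prems have "full (length (True # \<mu>)) u" by simp
  with Node.IH[of u "Suc d"] ts obtain e es where "labels (True # \<mu>) (Suc d) u = e # es" "Suc d \<le> e"
    by auto
  then show ?case using ts by simp
qed simp

lemma labels_last_marked:
  assumes "full (length (\<mu> @ [True])) T"
  shows "\<exists>e es. labels (\<mu> @ [True]) d T = es @ [e] \<and> d \<le> e"
  using assms
proof (induction T arbitrary: d)
  case (Node ts)
  then obtain u us where ts: "ts = us @ [u]" by (cases ts rule: rev_cases) auto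
  with Node.prems have u: "full (length (\<mu> @ [True])) u" "length us = length \<mu>" by auto
  with Node.IH[of u "Suc d"] ts obtain e es where "labels (\<mu> @ [True]) (Suc d) u = es @ [e]" "Suc d \<le> e"
    by auto
  then show ?case using ts u(2) by (simp add: forest_labels_append)
qed simp

lemma labels_Node_first_marked:
  assumes "full (length (True # \<mu>)) (Node ts)"
  shows "labels (True # \<mu>) d (Node ts) @ xs \<noteq> d # ys"
proof -
  obtain u us where ts: "ts = u # us" using assms by (cases ts) auto
  with assms obtain e es where "labels (True # \<mu>) (Suc d) u = e # es" "Suc d \<le> e"
    using labels_first_marked[of \<mu> u "Suc d"] by auto
  then show ?thesis using ts by simp
qed

lemma labels_Node_last_marked:
  assumes "full (length (\<mu> @ [True])) (Node ts)"
  shows "xs @ labels (\<mu> @ [True]) d (Node ts) \<noteq> ys @ [d]"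
proof -
  obtain u us where ts: "ts = us @ [u]" using assms by (cases ts rule: rev_cases) auto
  with assms obtain e es where "labels (\<mu> @ [True]) (Suc d) u = es @ [e]" "Suc d \<le> e"
    using labels_last_marked[of \<mu> u "Suc d"] by (auto simp: list_all_iff)
  moreover have "length us = length \<mu>" using assms ts by simp
  ultimately show ?thesis using ts by (simp add: forest_labels_append)
qed

lemma
  assumes \<mu>: "\<mu> = True # \<mu>'"
  shows labels_prefix_free: "full (length \<mu>) T \<Longrightarrow> full (length \<mu>) U \<Longrightarrow>
      labels \<mu> d T @ xs = labels \<mu> d U @ ys \<Longrightarrow> T = U \<and> xs = ys"
    and forest_labels_prefix_free: "\<forall>t\<in>set ts. full (length \<mu>) t \<Longrightarrow> \<forall>u\<in>set us. full (length \<mu>) u \<Longrightarrow>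
      length es = length ts \<Longrightarrow> length us = length ts \<Longrightarrow>
      forest_labels \<mu> es ts @ xs = forest_labels \<mu> es us @ ys \<Longrightarrow> ts = us \<and> xs = ys"
proof (induction T and ts arbitrary: U d xs ys and us es xs ys rule: tree_forest_induct)
  case Leaf
  then show ?case
    using labels_Node_first_marked[of \<mu>' _ d ys xs] \<mu> by (cases U) auto
next
  case (Node ts)
  show ?case
  proof (cases U)
    case Leaf
    then show ?thesis using labels_Node_first_marked[of \<mu>' ts d xs ys] Node.prems \<mu> by auto
  next
    case U: (Node us)
    have "ts = us \<and> xs = ys"
      by (rule Node.IH[where es = "map (\<lambda>m. if m then Suc d else 0) \<mu>"])
         (use Node.prems U in \<open>auto simp: list_all_iff\<close>)
    then show ?thesis using U by simp
  qed
next
  case (Cons t ts)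
  then obtain e es' u us' where *: "es = e # es'" "us = u # us'"
    by (metis length_Suc_conv length_Cons)
  then have "labels \<mu> e t @ (forest_labels \<mu> es' ts @ xs) = labels \<mu> e u @ (forest_labels \<mu> es' us' @ ys)"
    using Cons.prems(5) by simp
  then have "t = u \<and> forest_labels \<mu> es' ts @ xs = forest_labels \<mu> es' us' @ ys"
    by (rule Cons.IH(1)[rotated -1]) (use Cons.prems * in auto)
  moreover from this have "ts = us' \<and> xs = ys"
    by (intro Cons.IH(2)[of us' es']) (use Cons.prems * in auto)
  ultimately show ?case using * by simp
qed auto

lemma
  assumes \<mu>: "\<mu> = \<mu>' @ [True]"
  shows labels_suffix_free: "full (length \<mu>) T \<Longrightarrow> full (length \<mu>) U \<Longrightarrow>
      xs @ labels \<mu> d T = ys @ labels \<mu> d U \<Longrightarrow> T = U \<and> xs = ys"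
    and forest_labels_suffix_free: "\<forall>t\<in>set ts. full (length \<mu>) t \<Longrightarrow> \<forall>u\<in>set us. full (length \<mu>) u \<Longrightarrow>
      length es = length ts \<Longrightarrow> length us = length ts \<Longrightarrow>
      xs @ forest_labels \<mu> es ts = ys @ forest_labels \<mu> es us \<Longrightarrow> ts = us \<and> xs = ys"
proof (induction T and ts arbitrary: U d xs ys and us es xs ys rule: tree_forest_induct)
  case Leaf
  then show ?case
    using labels_Node_last_marked[of \<mu>' _ ys d xs] \<mu> by (cases U) auto
next
  case (Node ts)
  show ?case
  proof (cases U)
    case Leaf
    then show ?thesis using labels_Node_last_marked[of \<mu>' ts xs d ys] Node.prems \<mu> by auto
  next
    case U: (Node us)
    have "ts = us \<and> xs = ys"
      by (rule Node.IH[where es = "map (\<lambda>m. if m then Suc d else 0) \<mu>"])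
         (use Node.prems U in \<open>auto simp: list_all_iff\<close>)
    then show ?thesis using U by simp
  qed
next
  case (Cons t ts)
  then obtain e es' u us' where *: "es = e # es'" "us = u # us'"
    by (metis length_Suc_conv length_Cons)
  then have "(xs @ labels \<mu> e t) @ forest_labels \<mu> es' ts = (ys @ labels \<mu> e u) @ forest_labels \<mu> es' us'"
    using Cons.prems(5) by simp
  then have "ts = us' \<and> xs @ labels \<mu> e t = ys @ labels \<mu> e u"
    by (rule Cons.IH(2)[rotated -1]) (use Cons.prems * in auto)
  moreover from this have "t = u \<and> xs = ys"
    by (intro Cons.IH(1)[of u _ e]) (use Cons.prems * in auto)
  ultimately show ?case using * by simp
qed auto

lemma labels_inj:
  assumes "hd \<mu> \<or> last \<mu>" and "\<mu> \<noteq> []"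
    and "full (length \<mu>) T" "full (length \<mu>) U" "labels \<mu> d T = labels \<mu> d U"
  shows "T = U"
proof (cases "hd \<mu>")
  case True
  then have "\<mu> = True # tl \<mu>" using assms(2) by (cases \<mu>) auto
  from labels_prefix_free[OF this assms(3,4), of d "[]" "[]"] assms(5) show ?thesis by simp
next
  case False
  then have "\<mu> = butlast \<mu> @ [True]" using assms(1,2) by (metis (full_types) append_butlast_last_id)
  from labels_suffix_free[OF this assms(3,4), of "[]" d "[]"] assms(5) show ?thesis by simp
qed

section \<open>Vines and perfect trees\<close>

lemma left_vine_eq_chain_tree: "r \<ge> 1 \<Longrightarrow> left_vine r k = chain_tree (True # replicate (r - 1) False) k"
  by (induction k) (auto simp: map_replicate_const)

lemma right_vine_eq_chain_tree: "r \<ge> 1 \<Longrightarrow> right_vine r k = chain_tree (replicate (r - 1) False @ [True]) k"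
  by (induction k) auto

lemma perfect_eq_chain_tree: "perfect r k = chain_tree (replicate r True) k"
  by (induction k) auto

lemma leaves_left_vine: "r \<ge> 1 \<Longrightarrow> leaves (left_vine r k) = 1 + k * (r - 1)"
  by (induction k) (auto simp: sum_list_replicate)

lemma leaves_right_vine: "r \<ge> 1 \<Longrightarrow> leaves (right_vine r k) = 1 + k * (r - 1)"
  by (induction k) (auto simp: sum_list_replicate)

lemma leaves_perfect: "leaves (perfect r h) = r ^ h"
  by (induction h) (auto simp: sum_list_replicate)

section \<open>Central factors and products of tuples\<close>

text \<open>The premise of these rules mentions a length or a carrier that the conclusion does not
  determine, so as rewrite rules they lead to open-ended searches.\<close>

declare nlistsE_length [simp del] nlistsE_set [simp del]

lemma nlists_take_drop:
  "xs \<in> nlists (m + n) A \<Longrightarrow> take m xs \<in> nlists m A \<and> drop m xs \<in> nlists n A"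
  using set_take_subset[of m xs] set_drop_subset[of m xs] by (auto simp: nlists_def)

context group
begin

lemma center_closed: "z \<in> center G \<Longrightarrow> z \<in> carrier G"
  by (simp add: center_def)

lemma center_commute: "z \<in> center G \<Longrightarrow> g \<in> carrier G \<Longrightarrow> z \<otimes> g = g \<otimes> z"
  by (simp add: center_def)

lemma centerI: "z \<in> carrier G \<Longrightarrow> (\<And>g. g \<in> carrier G \<Longrightarrow> z \<otimes> g = g \<otimes> z) \<Longrightarrow> z \<in> center G"
  by (simp add: center_def)

lemma subgroup_center: "subgroup (center G) G"
proof
  fix x y assume xy: "x \<in> center G" "y \<in> center G"
  show "x \<otimes> y \<in> center G"
  proof (rule centerI)
    show "x \<otimes> y \<otimes> g = g \<otimes> (x \<otimes> y)" if "g \<in> carrier G" for g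
      using xy that by (metis center_closed center_commute m_assoc)
  qed (simp add: xy center_closed)
next
  fix x assume x: "x \<in> center G"
  show "inv x \<in> center G"
  proof (rule centerI)
    show "inv x \<otimes> g = g \<otimes> inv x" if "g \<in> carrier G" for g
      using center_commute[OF x that] center_closed[OF x] that
      by (metis inv_closed inv_solve_left inv_solve_right m_assoc m_closed)
  qed (simp add: x center_closed)
qed (auto simp: center_def)

lemmas center_mult [intro] = subgroup.m_closed[OF subgroup_center]
lemmas center_one [intro, simp] = subgroup.one_closed[OF subgroup_center]
lemmas center_inv [intro] = subgroup.m_inv_closed[OF subgroup_center]

lemma center_pow: "c \<in> center G \<Longrightarrow> c [^] (n :: nat) \<in> center G"
  by (induction n) auto

lemma normal_center: "center G \<lhd> G"
  by (rule normalI[OF subgroup_center]) (auto simp: r_coset_def l_coset_def center_commute)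

lemma central_mult_mult:
  assumes "z \<in> center G" "w \<in> center G" "x \<in> carrier G" "y \<in> carrier G"
  shows "(z \<otimes> x) \<otimes> (w \<otimes> y) = (z \<otimes> w) \<otimes> (x \<otimes> y)"
proof -
  have "x \<otimes> (w \<otimes> y) = w \<otimes> (x \<otimes> y)"
    using assms by (metis center_closed center_commute m_assoc)
  then show ?thesis using assms center_closed by (simp add: m_assoc)
qed

lemma list_prod_simps [simp]:
  "list_prod G [] = \<one>" "list_prod G (x # xs) = x \<otimes> list_prod G xs"
  by (simp_all add: list_prod_def)

lemma list_prod_closed [simp]: "set xs \<subseteq> carrier G \<Longrightarrow> list_prod G xs \<in> carrier G"
  by (induction xs) auto

lemma list_prod_nlists_closed: "xs \<in> nlists n (carrier G) \<Longrightarrow> list_prod G xs \<in> carrier G"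
  by (blast intro: list_prod_closed dest: nlistsE_set)

lemma list_prod_append:
  "set xs \<subseteq> carrier G \<Longrightarrow> set ys \<subseteq> carrier G \<Longrightarrow> list_prod G (xs @ ys) = list_prod G xs \<otimes> list_prod G ys"
  by (induction xs) (auto simp: m_assoc)

lemma list_prod_take_drop:
  assumes "xs \<in> nlists n (carrier G)"
  shows "list_prod G xs = list_prod G (take m xs) \<otimes> list_prod G (drop m xs)"
proof -
  have "set (take m xs) \<subseteq> carrier G" "set (drop m xs) \<subseteq> carrier G"
    using nlistsE_set[OF assms] set_take_subset set_drop_subset by fast+
  then show ?thesis by (metis append_take_drop_id list_prod_append)
qed

lemma
  assumes q: "\<And>xs. xs \<in> nlists m (carrier G) \<Longrightarrow> q xs \<in> carrier G"
  shows tree_op_closed: "full m T \<Longrightarrow> xs \<in> nlists (leaves T) (carrier G) \<Longrightarrow> tree_op q T xs \<in> carrier G"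
    and forest_op_closed: "\<forall>t\<in>set ts. full m t \<Longrightarrow> xs \<in> nlists (sum_list (map leaves ts)) (carrier G) \<Longrightarrow>
      forest_op q ts xs \<in> nlists (length ts) (carrier G)"
proof (induction T and ts arbitrary: xs and xs rule: tree_forest_induct)
  case (Leaf xs)
  then show ?case by (auto simp: nlists_def length_Suc_conv)
next
  case (Node ts xs)
  then show ?case using q by (simp add: list_all_iff)
next
  case (Cons t ts xs)
  then show ?case using nlists_take_drop[of xs "leaves t" "sum_list (map leaves ts)"] by simp
qed auto

text \<open>Every internal vertex contributes one factor \<open>c\<close>, which can be moved to the front. The
  number \<open>n\<close> of internal vertices is tied to the number of leaves, which is what makes the value
  independent of the shape of the tree.\<close>

lemma
  assumes c: "c \<in> center G" and m: "m \<ge> 1"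
    and q: "\<And>xs. xs \<in> nlists m (carrier G) \<Longrightarrow> q xs = c \<otimes> list_prod G xs"
  shows tree_op_central_product: "full m T \<Longrightarrow> \<exists>n. leaves T = 1 + n * (m - 1) \<and>
      (\<forall>xs\<in>nlists (leaves T) (carrier G). tree_op q T xs = c [^] n \<otimes> list_prod G xs)"
    and forest_op_central_product: "\<forall>t\<in>set ts. full m t \<Longrightarrow>
      \<exists>n. sum_list (map leaves ts) = length ts + n * (m - 1) \<and>
      (\<forall>xs\<in>nlists (sum_list (map leaves ts)) (carrier G).
        list_prod G (forest_op q ts xs) = c [^] n \<otimes> list_prod G xs)"
proof (induction T and ts rule: tree_forest_induct)
  case Leaf
  have "hd xs = \<one> \<otimes> list_prod G xs" if "xs \<in> nlists 1 (carrier G)" for xs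
    using that by (auto simp: nlists_def length_Suc_conv)
  then show ?case by (intro exI[of _ 0]) simp
next
  case (Node ts)
  then have ts: "length ts = m" "\<forall>t\<in>set ts. full m t" by (auto simp: list_all_iff)
  from Node.IH[OF ts(2)] obtain n where n: "sum_list (map leaves ts) = length ts + n * (m - 1)"
    "\<And>xs. xs \<in> nlists (sum_list (map leaves ts)) (carrier G) \<Longrightarrow>
        list_prod G (forest_op q ts xs) = c [^] n \<otimes> list_prod G xs" by blast
  have closed: "q xs \<in> carrier G" if "xs \<in> nlists m (carrier G)" for xs
    using q[OF that] list_prod_nlists_closed[OF that] c by (simp add: center_closed)
  have "tree_op q (Node ts) xs = c [^] Suc n \<otimes> list_prod G xs"
    if xs: "xs \<in> nlists (leaves (Node ts)) (carrier G)" for xs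
  proof -
    have "forest_op q ts xs \<in> nlists m (carrier G)"
      using forest_op_closed[OF closed ts(2)] xs ts(1) by simp
    then have "tree_op q (Node ts) xs = c \<otimes> (c [^] n \<otimes> list_prod G xs)"
      using q n(2) xs by simp
    also have "\<dots> = c [^] Suc n \<otimes> list_prod G xs"
      using list_prod_nlists_closed[OF xs] center_closed[OF c] by (metis m_assoc nat_pow_Suc2 nat_pow_closed)
    finally show ?thesis .
  qed
  moreover have "leaves (Node ts) = 1 + Suc n * (m - 1)"
    using n(1) ts(1) m by simp
  ultimately show ?case by blast
next
  case Nil
  then show ?case by (intro exI[of _ 0]) simp
next
  case (Cons t ts)
  then obtain n n' where n: "leaves t = 1 + n * (m - 1)"
      "\<And>xs. xs \<in> nlists (leaves t) (carrier G) \<Longrightarrow> tree_op q t xs = c [^] n \<otimes> list_prod G xs"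
    and n': "sum_list (map leaves ts) = length ts + n' * (m - 1)"
      "\<And>xs. xs \<in> nlists (sum_list (map leaves ts)) (carrier G) \<Longrightarrow>
        list_prod G (forest_op q ts xs) = c [^] n' \<otimes> list_prod G xs"
    by (metis list.set_intros)
  have "list_prod G (forest_op q (t # ts) xs) = c [^] (n + n') \<otimes> list_prod G xs"
    if xs: "xs \<in> nlists (sum_list (map leaves (t # ts))) (carrier G)" for xs
  proof -
    let ?ys = "take (leaves t) xs" and ?zs = "drop (leaves t) xs"
    have split: "?ys \<in> nlists (leaves t) (carrier G)"
        "?zs \<in> nlists (sum_list (map leaves ts)) (carrier G)"
      using nlists_take_drop[of xs "leaves t" "sum_list (map leaves ts)" "carrier G"] xs by simp_all
    have "list_prod G (forest_op q (t # ts) xs) =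
        (c [^] n \<otimes> list_prod G ?ys) \<otimes> (c [^] n' \<otimes> list_prod G ?zs)"
      using n(2) n'(2) split by simp
    also have "\<dots> = (c [^] n \<otimes> c [^] n') \<otimes> (list_prod G ?ys \<otimes> list_prod G ?zs)"
      using c split by (intro central_mult_mult center_pow list_prod_nlists_closed)
    also have "\<dots> = c [^] (n + n') \<otimes> list_prod G xs"
      using center_closed[OF c] by (simp add: nat_pow_mult list_prod_take_drop[symmetric, OF xs])
    finally show ?thesis .
  qed
  moreover have "sum_list (map leaves (t # ts)) = length (t # ts) + (n + n') * (m - 1)"
    using n(1) n'(1) by (simp add: add_mult_distrib)
  ultimately show ?case by blast
qed

lemma tree_op_central_product_eq:
  assumes "c \<in> center G" and "m \<ge> 2"
    and "\<And>xs. xs \<in> nlists m (carrier G) \<Longrightarrow> q xs = c \<otimes> list_prod G xs"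
    and "(T, U) \<in> tree_pairs m" and "xs \<in> nlists (leaves T) (carrier G)"
  shows "tree_op q T xs = tree_op q U xs"
proof -
  have m: "m \<ge> 1" using assms(2) by simp
  have TU: "full m T" "full m U" "leaves T = leaves U"
    using assms(4) by (auto simp: tree_pairs_def)
  obtain n where n: "leaves T = 1 + n * (m - 1)"
    "\<forall>xs\<in>nlists (leaves T) (carrier G). tree_op q T xs = c [^] n \<otimes> list_prod G xs"
    using tree_op_central_product[OF assms(1) m assms(3) TU(1)] by blast
  obtain n' where n': "leaves U = 1 + n' * (m - 1)"
    "\<forall>xs\<in>nlists (leaves U) (carrier G). tree_op q U xs = c [^] n' \<otimes> list_prod G xs"
    using tree_op_central_product[OF assms(1) m assms(3) TU(2)] by blast
  have "n = n'" using n(1) n'(1) TU(3) assms(2) by simp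
  then show ?thesis using n n' TU(3) assms(5) by simp
qed

lemma Assoc_central_product:
  assumes "c \<in> center G" and "r \<ge> 2"
    and "\<And>xs. xs \<in> nlists r (carrier G) \<Longrightarrow> \<omega> xs = c \<otimes> list_prod G xs"
  shows "Assoc r (carrier G) \<omega> = carrier (HT r)"
proof -
  have "\<exists>(T, U)\<in>A. \<forall>xs\<in>nlists (leaves T) (carrier G). tree_op \<omega> T xs = tree_op \<omega> U xs"
    if "A \<in> carrier (HT r)" for A
  proof -
    from that obtain T U where TU: "A = pair_class r T U" "(T, U) \<in> tree_pairs r"
      by (auto simp: carrier_HT)
    have "\<forall>xs\<in>nlists (leaves T) (carrier G). tree_op \<omega> T xs = tree_op \<omega> U xs"
      using tree_op_central_product_eq[OF assms TU(2)] by blast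
    then show ?thesis using pair_class_self[OF TU(2)] TU(1) by blast
  qed
  then show ?thesis by (auto simp: Assoc_def)
qed

end

section \<open>Operations twisted along marked children\<close>

text \<open>The common structure of a factor on the left, a factor on the right and an automorphism. The
  assumption \<open>twist_\<omega>\<close> is the recursion step: \<open>\<phi> d\<close> applied to a value of \<open>\<omega>\<close> is distributed over
  the arguments by the labels that a root with label \<open>d\<close> gives to its children. The assumption
  \<open>twist_separates\<close> says that the twisted products determine their exponents modulo \<open>k\<close>, even up
  to central factors; with \<open>k = 0\<close> it determines them completely, since \<open>d mod 0 = d\<close>.\<close>

locale twisted_product = group G for G (structure) +
  fixes r :: nat and \<omega> :: "'a list \<Rightarrow> 'a" and \<mu> :: "bool list"
    and \<phi> :: "nat \<Rightarrow> 'a \<Rightarrow> 'a" and k :: nat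
  assumes arity: "r \<ge> 2" "length \<mu> = r"
    and outer_mark: "hd \<mu> \<or> last \<mu>"
    and \<omega>_closed: "xs \<in> nlists r (carrier G) \<Longrightarrow> \<omega> xs \<in> carrier G"
    and twist_closed: "x \<in> carrier G \<Longrightarrow> \<phi> d x \<in> carrier G"
    and twist_0: "x \<in> carrier G \<Longrightarrow> \<phi> 0 x = x"
    and twist_\<omega>: "\<exists>z\<in>center G. \<forall>xs\<in>nlists r (carrier G).
      \<phi> d (\<omega> xs) = z \<otimes> list_prod G (map2 \<phi> (map (\<lambda>m. if m then Suc d else 0) \<mu>) xs)"
    and twist_period: "k \<noteq> 0 \<Longrightarrow> \<exists>c\<in>center G. \<forall>x\<in>carrier G. \<phi> k x = c \<otimes> x"
    and twist_separates: "z \<in> center G \<Longrightarrow> z' \<in> center G \<Longrightarrow> length ds = length ds' \<Longrightarrow>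
      (\<And>xs. xs \<in> nlists (length ds) (carrier G) \<Longrightarrow>
        z \<otimes> list_prod G (map2 \<phi> ds xs) = z' \<otimes> list_prod G (map2 \<phi> ds' xs)) \<Longrightarrow>
      map (\<lambda>d. d mod k) ds = map (\<lambda>d. d mod k) ds'"
begin

lemma twisted_closed: "xs \<in> nlists n (carrier G) \<Longrightarrow> set (map2 \<phi> ds xs) \<subseteq> carrier G"
  using twist_closed by (auto dest!: set_zip_rightD nlistsE_set)

lemma
  shows twist_tree_op: "full r T \<Longrightarrow> \<exists>z\<in>center G. \<forall>xs\<in>nlists (leaves T) (carrier G).
      \<phi> d (tree_op \<omega> T xs) = z \<otimes> list_prod G (map2 \<phi> (labels \<mu> d T) xs)"
    and twist_forest_op: "\<forall>t\<in>set ts. full r t \<Longrightarrow> length es = length ts \<Longrightarrow>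
      \<exists>z\<in>center G. \<forall>xs\<in>nlists (sum_list (map leaves ts)) (carrier G).
        list_prod G (map2 \<phi> es (forest_op \<omega> ts xs)) =
        z \<otimes> list_prod G (map2 \<phi> (forest_labels \<mu> es ts) xs)"
proof (induction T and ts arbitrary: d and es rule: tree_forest_induct)
  case Leaf
  have "\<phi> d (hd xs) = \<one> \<otimes> list_prod G (map2 \<phi> [d] xs)" if "xs \<in> nlists 1 (carrier G)" for xs
    using that by (auto simp: nlists_def length_Suc_conv twist_closed)
  then show ?case by (intro bexI[of _ \<one>]) auto
next
  case (Node ts)
  let ?es = "map (\<lambda>m. if m then Suc d else 0) \<mu>"
  have ts: "length ts = r" "\<forall>t\<in>set ts. full r t"
    using Node.prems by (auto simp: list_all_iff)
  obtain z where z: "z \<in> center G" "\<And>xs. xs \<in> nlists r (carrier G) \<Longrightarrow>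
      \<phi> d (\<omega> xs) = z \<otimes> list_prod G (map2 \<phi> ?es xs)"
    using twist_\<omega>[of d] by blast
  obtain z' where z': "z' \<in> center G" "\<And>xs. xs \<in> nlists (sum_list (map leaves ts)) (carrier G) \<Longrightarrow>
      list_prod G (map2 \<phi> ?es (forest_op \<omega> ts xs)) =
        z' \<otimes> list_prod G (map2 \<phi> (forest_labels \<mu> ?es ts) xs)"
    using Node.IH[OF ts(2), of ?es] ts(1) arity(2) by auto
  have "\<phi> d (tree_op \<omega> (Node ts) xs) = (z \<otimes> z') \<otimes> list_prod G (map2 \<phi> (labels \<mu> d (Node ts)) xs)"
    if xs: "xs \<in> nlists (leaves (Node ts)) (carrier G)" for xs
  proof -
    have "forest_op \<omega> ts xs \<in> nlists r (carrier G)"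
      using forest_op_closed[OF \<omega>_closed ts(2)] xs ts(1) by simp
    then have "\<phi> d (tree_op \<omega> (Node ts) xs) = z \<otimes> (z' \<otimes> list_prod G (map2 \<phi> (forest_labels \<mu> ?es ts) xs))"
      using z(2) z'(2) xs by simp
    then show ?thesis
      using z(1) z'(1) list_prod_closed[OF twisted_closed[OF xs]] by (simp add: m_assoc center_closed)
  qed
  then show ?case using z(1) z'(1) by (intro bexI[of _ "z \<otimes> z'"]) auto
next
  case Nil
  show ?case by (intro bexI[of _ \<one>]) auto
next
  case (Cons t ts)
  obtain e es' where es: "es = e # es'" "length es' = length ts"
    using Cons.prems(2) by (auto simp: length_Suc_conv)
  have full: "full r t" "\<forall>t\<in>set ts. full r t" using Cons.prems by auto
  obtain z where z: "z \<in> center G" "\<And>xs. xs \<in> nlists (leaves t) (carrier G) \<Longrightarrow>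
      \<phi> e (tree_op \<omega> t xs) = z \<otimes> list_prod G (map2 \<phi> (labels \<mu> e t) xs)"
    using Cons.IH(1)[OF full(1), of e] by blast
  obtain z' where z': "z' \<in> center G" "\<And>xs. xs \<in> nlists (sum_list (map leaves ts)) (carrier G) \<Longrightarrow>
      list_prod G (map2 \<phi> es' (forest_op \<omega> ts xs)) =
        z' \<otimes> list_prod G (map2 \<phi> (forest_labels \<mu> es' ts) xs)"
    using Cons.IH(2)[OF full(2) es(2)] by blast
  have "list_prod G (map2 \<phi> es (forest_op \<omega> (t # ts) xs)) =
      (z \<otimes> z') \<otimes> list_prod G (map2 \<phi> (forest_labels \<mu> es (t # ts)) xs)"
    if xs: "xs \<in> nlists (sum_list (map leaves (t # ts))) (carrier G)" for xs
  proof -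
    let ?ys = "take (leaves t) xs" and ?zs = "drop (leaves t) xs"
    have split: "?ys \<in> nlists (leaves t) (carrier G)"
        "?zs \<in> nlists (sum_list (map leaves ts)) (carrier G)"
      using nlists_take_drop[of xs "leaves t" "sum_list (map leaves ts)" "carrier G"] xs by simp_all
    have closed: "set (map2 \<phi> (labels \<mu> e t) ?ys) \<subseteq> carrier G"
        "set (map2 \<phi> (forest_labels \<mu> es' ts) ?zs) \<subseteq> carrier G"
      using split twisted_closed by blast+
    have "list_prod G (map2 \<phi> es (forest_op \<omega> (t # ts) xs)) =
        (z \<otimes> list_prod G (map2 \<phi> (labels \<mu> e t) ?ys)) \<otimes>
        (z' \<otimes> list_prod G (map2 \<phi> (forest_labels \<mu> es' ts) ?zs))"
      using z(2) z'(2) split by (simp add: es)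
    also have "\<dots> = (z \<otimes> z') \<otimes> (list_prod G (map2 \<phi> (labels \<mu> e t) ?ys) \<otimes>
        list_prod G (map2 \<phi> (forest_labels \<mu> es' ts) ?zs))"
      using z(1) z'(1) closed by (intro central_mult_mult list_prod_closed)
    also have "\<dots> = (z \<otimes> z') \<otimes> list_prod G (map2 \<phi> (forest_labels \<mu> es (t # ts)) xs)"
      using closed full(1) arity(2)
      by (simp add: es zip_append1 length_labels flip: list_prod_append)
    finally show ?thesis .
  qed
  then show ?case using z(1) z'(1) by (intro bexI[of _ "z \<otimes> z'"]) auto
qed

lemma tree_op_eq_labels:
  assumes "full r T"
  shows "\<exists>z\<in>center G. \<forall>xs\<in>nlists (leaves T) (carrier G).
    tree_op \<omega> T xs = z \<otimes> list_prod G (map2 \<phi> (labels \<mu> 0 T) xs)"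
  using twist_tree_op[OF assms, of 0] tree_op_closed[OF \<omega>_closed assms] by (simp add: twist_0)

lemma tree_op_eq_imp_labels_mod:
  assumes "(T, U) \<in> tree_pairs r"
    and "\<forall>xs\<in>nlists (leaves T) (carrier G). tree_op \<omega> T xs = tree_op \<omega> U xs"
  shows "map (\<lambda>d. d mod k) (labels \<mu> 0 T) = map (\<lambda>d. d mod k) (labels \<mu> 0 U)"
proof -
  have TU: "full r T" "full r U" "leaves T = leaves U"
    using assms(1) by (auto simp: tree_pairs_def)
  obtain z where z: "z \<in> center G" "\<forall>xs\<in>nlists (leaves T) (carrier G).
      tree_op \<omega> T xs = z \<otimes> list_prod G (map2 \<phi> (labels \<mu> 0 T) xs)"
    using tree_op_eq_labels[OF TU(1)] by blast
  obtain z' where z': "z' \<in> center G" "\<forall>xs\<in>nlists (leaves U) (carrier G).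
      tree_op \<omega> U xs = z' \<otimes> list_prod G (map2 \<phi> (labels \<mu> 0 U) xs)"
    using tree_op_eq_labels[OF TU(2)] by blast
  have len: "length (labels \<mu> 0 T) = leaves T" "length (labels \<mu> 0 U) = leaves T"
    using TU arity(2) by (simp_all add: length_labels)
  show ?thesis
  proof (rule twist_separates[OF z(1) z'(1)])
    show "z \<otimes> list_prod G (map2 \<phi> (labels \<mu> 0 T) xs) = z' \<otimes> list_prod G (map2 \<phi> (labels \<mu> 0 U) xs)"
      if "xs \<in> nlists (length (labels \<mu> 0 T)) (carrier G)" for xs
      using that z(2) z'(2) assms(2) TU(3) len by metis
  qed (simp add: len)
qed

text \<open>The labels of the chain tree are 0 and \<open>k\<close>, and both \<open>\<phi> 0\<close> and \<open>\<phi> k\<close> multiply by a central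
  element.\<close>

lemma chain_tree_central_product:
  assumes "k \<noteq> 0"
  shows "\<exists>c\<in>center G. \<forall>xs\<in>nlists (leaves (chain_tree \<mu> k)) (carrier G).
    tree_op \<omega> (chain_tree \<mu> k) xs = c \<otimes> list_prod G xs"
proof -
  obtain c where c: "c \<in> center G" "\<And>x. x \<in> carrier G \<Longrightarrow> \<phi> k x = c \<otimes> x"
    using twist_period[OF assms] by blast
  have untwist: "\<exists>z\<in>center G. \<forall>xs\<in>nlists (length ds) (carrier G).
      list_prod G (map2 \<phi> ds xs) = z \<otimes> list_prod G xs" if "set ds \<subseteq> {0, k}" for ds
    using that
  proof (induction ds)
    case Nil
    show ?case by (intro bexI[of _ \<one>]) auto
  next
    case (Cons d ds)
    then obtain z where z: "z \<in> center G" "\<And>xs. xs \<in> nlists (length ds) (carrier G) \<Longrightarrow>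
      list_prod G (map2 \<phi> ds xs) = z \<otimes> list_prod G xs" by auto
    define c' where "c' = (if d = 0 then \<one> else c)"
    have c': "c' \<in> center G" "\<And>x. x \<in> carrier G \<Longrightarrow> \<phi> d x = c' \<otimes> x"
      using Cons.prems c twist_0 by (auto simp: c'_def)
    have "list_prod G (map2 \<phi> (d # ds) xs) = (c' \<otimes> z) \<otimes> list_prod G xs"
      if len: "xs \<in> nlists (length (d # ds)) (carrier G)" for xs
    proof -
      obtain x ys where xs: "xs = x # ys" "x \<in> carrier G" "ys \<in> nlists (length ds) (carrier G)"
        using len by (auto simp: in_nlists_Suc_iff)
      then show ?thesis
        using central_mult_mult[OF c'(1) z(1) xs(2) list_prod_nlists_closed[OF xs(3)]] z(2) c'(2)
        by simp
    qed
    then show ?case using z(1) c'(1) by (intro bexI[of _ "c' \<otimes> z"]) auto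
  qed
  let ?C = "chain_tree \<mu> k"
  have C: "full r ?C" using full_chain_tree[of \<mu> k] arity(2) by simp
  have "set (labels \<mu> 0 ?C) \<subseteq> {0, k}"
    using labels_chain_tree[of _ \<mu> 0 k] by auto
  then obtain z where z: "z \<in> center G" "\<And>xs. xs \<in> nlists (leaves ?C) (carrier G) \<Longrightarrow>
      list_prod G (map2 \<phi> (labels \<mu> 0 ?C) xs) = z \<otimes> list_prod G xs"
    using untwist[of "labels \<mu> 0 ?C"] C arity(2) by (auto simp: length_labels)
  obtain z' where z': "z' \<in> center G" "\<And>xs. xs \<in> nlists (leaves ?C) (carrier G) \<Longrightarrow>
      tree_op \<omega> ?C xs = z' \<otimes> list_prod G (map2 \<phi> (labels \<mu> 0 ?C) xs)"
    using tree_op_eq_labels[OF C] by blast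
  have "tree_op \<omega> ?C xs = (z' \<otimes> z) \<otimes> list_prod G xs" if "xs \<in> nlists (leaves ?C) (carrier G)" for xs
    using that z z' list_prod_nlists_closed[OF that] by (simp add: m_assoc center_closed)
  then show ?thesis using z(1) z'(1) by (intro bexI[of _ "z' \<otimes> z"]) auto
qed

lemma leaves_chain_tree_ge_2:
  assumes "k \<noteq> 0"
  shows "leaves (chain_tree \<mu> k) \<ge> 2"
proof -
  obtain ts where ts: "chain_tree \<mu> k = Node ts" using assms by (cases k) auto
  then have "length ts = r" "\<forall>t\<in>set ts. full r t"
    using full_chain_tree[of \<mu> k] arity(2) by (simp_all add: list_all_iff)
  then show ?thesis
    using leaves_forest_ge_length[of ts r] arity(1) ts by simp
qed

lemma iota_chain_tree_subset_Assoc: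
  assumes k: "k \<noteq> 0"
  shows "iota r (chain_tree \<mu> k) ` carrier (HT (leaves (chain_tree \<mu> k))) \<subseteq> Assoc r (carrier G) \<omega>"
proof -
  let ?C = "chain_tree \<mu> k"
  have C: "full r ?C" using full_chain_tree[of \<mu> k] arity(2) by simp
  obtain c where c: "c \<in> center G" "\<And>xs. xs \<in> nlists (leaves ?C) (carrier G) \<Longrightarrow>
      tree_op \<omega> ?C xs = c \<otimes> list_prod G xs"
    using chain_tree_central_product[OF k] by blast
  have "pair_class r (subst_tree ?C T) (subst_tree ?C U) \<in> Assoc r (carrier G) \<omega>"
    if TU: "(T, U) \<in> tree_pairs (leaves ?C)" for T U
  proof -
    have pairs: "(subst_tree ?C T, subst_tree ?C U) \<in> tree_pairs r"
      using TU C by (simp add: tree_pairs_def full_subst_tree)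
    have "tree_op \<omega> (subst_tree ?C T) xs = tree_op \<omega> (subst_tree ?C U) xs"
      if xs: "xs \<in> nlists (leaves (subst_tree ?C T)) (carrier G)" for xs
    proof -
      have "xs \<in> nlists (leaves T) (carrier G)"
        using TU xs by (simp add: tree_pairs_def)
      from tree_op_central_product_eq[OF c(1) leaves_chain_tree_ge_2[OF k] c(2) TU this]
      show ?thesis
        using TU nlistsE_length[OF xs] by (simp add: tree_pairs_def tree_op_subst_tree)
    qed
    then show ?thesis
      using pairs pair_class_self[OF pairs] unfolding Assoc_def carrier_HT by blast
  qed
  then show ?thesis
    using iota_pair_class[OF arity(1) C] by (auto simp: carrier_HT)
qed

text \<open>Both trees are completed to multiples of \<open>k\<close> by the same grafted chain trees. This is
  possible because the height of the chain tree needed at a leaf depends only on its label modulo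
  \<open>k\<close>.\<close>

lemma Assoc_subset_iota_chain_tree:
  assumes k: "k \<noteq> 0"
  shows "Assoc r (carrier G) \<omega> \<subseteq> iota r (chain_tree \<mu> k) ` carrier (HT (leaves (chain_tree \<mu> k)))"
proof
  let ?C = "chain_tree \<mu> k"
  have C: "full r ?C" using full_chain_tree[of \<mu> k] arity(2) by simp
  fix A assume "A \<in> Assoc r (carrier G) \<omega>"
  then obtain T U where A: "A \<in> carrier (HT r)" "(T, U) \<in> A"
    and eq: "\<forall>xs\<in>nlists (leaves T) (carrier G). tree_op \<omega> T xs = tree_op \<omega> U xs"
    by (auto simp: Assoc_def)
  note rep = carrier_HT_rep[OF A]
  have TU: "full r T" "full r U" "leaves T = leaves U"
    using rep(2) by (auto simp: tree_pairs_def)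
  \<comment> \<open>A label d that is already a multiple of k is completed by the full height k rather than by 0; the formula is then uniform.\<close>
  define fill where "fill ds = map (\<lambda>d. chain_tree \<mu> (k - d mod k)) ds" for ds
  define Ss where "Ss = fill (labels \<mu> 0 T)"
  have fill_mod: "fill ds = map (\<lambda>d. chain_tree \<mu> (k - d)) (map (\<lambda>d. d mod k) ds)" for ds
    by (simp add: fill_def)
  have Ss_U: "Ss = fill (labels \<mu> 0 U)"
    unfolding Ss_def fill_mod by (simp only: tree_op_eq_imp_labels_mod[OF rep(2) eq])
  have Ss: "length Ss = leaves T" "\<forall>S\<in>set Ss. full r S"
    using TU arity(2) full_chain_tree[of \<mu>] by (auto simp: Ss_def fill_def length_labels)
  have multiples: "multiples k (forest_labels \<mu> ds (fill ds))" for ds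
  proof (induction ds)
    case (Cons d ds)
    have sum: "d + (k - d mod k) = k * (d div k + 1)"
    proof -
      have "d = k * (d div k) + d mod k" "d mod k < k"
        using k by simp_all
      then show ?thesis by (simp only: distrib_left mult_1_right)
    qed
    have "multiples k (labels \<mu> d (chain_tree \<mu> (k - d mod k)))"
    proof
      fix e assume "e \<in> set (labels \<mu> d (chain_tree \<mu> (k - d mod k)))"
      then have "e = 0 \<or> e = k * (d div k + 1)"
        unfolding sum[symmetric] by (rule labels_chain_tree)
      then show "k dvd e" by (elim disjE) (simp_all only: dvd_0_right dvd_triv_left)
    qed
    moreover have "forest_labels \<mu> (d # ds) (fill (d # ds)) =
        labels \<mu> d (chain_tree \<mu> (k - d mod k)) @ forest_labels \<mu> ds (fill ds)"
      by (simp add: fill_def)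
    ultimately show ?case
      using Cons.IH by (metis Un_iff set_append)
  qed simp
  have quotient: "\<exists>T'. full (leaves ?C) T' \<and> graft V Ss = subst_tree ?C T'"
    if "full r V" "leaves V = leaves T" "Ss = fill (labels \<mu> 0 V)" for V
  proof (rule multiples_labels_imp_subst_tree)
    show "full (length \<mu>) (graft V Ss)"
      using that Ss arity(2) by (auto intro!: full_graft)
    show "multiples k (labels \<mu> 0 (graft V Ss))"
      using that Ss(1) arity(2) multiples[of "labels \<mu> 0 V"] by (simp add: labels_graft)
  qed (use k in simp)
  obtain T' where T': "full (leaves ?C) T'" "graft T Ss = subst_tree ?C T'"
    using quotient[OF TU(1) refl Ss_def] by blast
  obtain U' where U': "full (leaves ?C) U'" "graft U Ss = subst_tree ?C U'"
    using quotient[OF TU(2) TU(3)[symmetric] Ss_U] by blast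
  have "leaves T' = leaves U'"
    using leaves_graft[of Ss T] leaves_graft[of Ss U] Ss(1) TU(3) T' U'
    by (metis leaves_subst_tree)
  then have pair: "(T', U') \<in> tree_pairs (leaves ?C)"
    using T'(1) U'(1) by (simp add: tree_pairs_def)
  have "A = pair_class r (graft T Ss) (graft U Ss)"
    using rep(1) pair_class_eq[OF pair_rel_graft[OF arity(1) rep(2) Ss]] by simp
  also have "\<dots> = iota r ?C (pair_class (leaves ?C) T' U')"
    using iota_pair_class[OF arity(1) C pair] T' U' by simp
  finally show "A \<in> iota r ?C ` carrier (HT (leaves ?C))"
    using pair by (auto simp: carrier_HT)
qed

lemma Assoc_eq_iota_chain_tree:
  "k \<noteq> 0 \<Longrightarrow> Assoc r (carrier G) \<omega> = iota r (chain_tree \<mu> k) ` carrier (HT (leaves (chain_tree \<mu> k)))"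
  using iota_chain_tree_subset_Assoc Assoc_subset_iota_chain_tree by blast

lemma Assoc_trivial:
  assumes "k = 0"
  shows "Assoc r (carrier G) \<omega> = {\<one>\<^bsub>HT r\<^esub>}"
proof (rule equalityI subsetI)+
  fix A assume "A \<in> Assoc r (carrier G) \<omega>"
  then obtain T U where A: "A \<in> carrier (HT r)" "(T, U) \<in> A"
    and eq: "\<forall>xs\<in>nlists (leaves T) (carrier G). tree_op \<omega> T xs = tree_op \<omega> U xs"
    by (auto simp: Assoc_def)
  note rep = carrier_HT_rep[OF A]
  have TU: "full (length \<mu>) T" "full (length \<mu>) U"
    using rep(2) arity(2) by (auto simp: tree_pairs_def)
  have "labels \<mu> 0 T = labels \<mu> 0 U"
    using tree_op_eq_imp_labels_mod[OF rep(2) eq] assms by simp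
  moreover have "\<mu> \<noteq> []" using arity by auto
  ultimately have "T = U" using labels_inj[OF outer_mark _ TU] by blast
  then show "A \<in> {\<one>\<^bsub>HT r\<^esub>}"
    using rep(1) pair_class_diag[OF arity(1)] TU(1) arity(2) by simp
next
  have "(Leaf, Leaf) \<in> tree_pairs r" by (simp add: tree_pairs_def)
  then show "{\<one>\<^bsub>HT r\<^esub>} \<subseteq> Assoc r (carrier G) \<omega>"
    using pair_class_self[of Leaf Leaf r] unfolding Assoc_def carrier_HT one_HT by blast
qed

end

section \<open>Separating the labels\<close>

context group
begin

lemma pow_eq_iff_mod_ord:
  assumes "x \<in> carrier G"
  shows "x [^] (m :: nat) = x [^] (n :: nat) \<longleftrightarrow> m mod ord x = n mod ord x"
proof -
  have "x [^] m = x [^] n \<longleftrightarrow> int (ord x) dvd int n - int m"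
    using int_pow_eq[OF assms, of "int m" "int n"] by (simp add: int_pow_int)
  also have "\<dots> \<longleftrightarrow> int n mod int (ord x) = int m mod int (ord x)"
    by (simp add: mod_eq_dvd_iff)
  also have "\<dots> \<longleftrightarrow> m mod ord x = n mod ord x"
    by (metis of_nat_eq_iff zmod_int)
  finally show ?thesis .
qed

lemma center_coset_pow:
  assumes "b \<in> carrier G"
  shows "(center G #> b) [^]\<^bsub>G Mod center G\<^esub> (n :: nat) = center G #> (b [^] n)"
proof -
  interpret Q: group "G Mod center G"
    using normal.factorgroup_is_group[OF normal_center] .
  have "(\<lambda>a. center G #> a) \<in> hom G (G Mod center G)"
    using normal.r_coset_hom_Mod[OF normal_center] .
  then interpret h: group_hom G "G Mod center G" "\<lambda>a. center G #> a"
    by unfold_locales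
  show ?thesis using h.hom_nat_pow[OF assms] by simp
qed

lemma center_coset_closed: "b \<in> carrier G \<Longrightarrow> center G #> b \<in> carrier (G Mod center G)"
  by (auto simp: FactGroup_def RCOSETS_def)

lemma pow_ord_mod_center:
  assumes "b \<in> carrier G"
  shows "b [^] ord_mod_center G b \<in> center G"
proof -
  interpret Q: group "G Mod center G"
    using normal.factorgroup_is_group[OF normal_center] .
  have "center G #> (b [^] ord_mod_center G b) = center G"
    using Q.pow_ord_eq_1[OF center_coset_closed[OF assms]] center_coset_pow[OF assms]
    by (simp add: ord_mod_center_def FactGroup_def)
  then show ?thesis
    using coset_join1[OF _ _ subgroup_center] assms by simp
qed

lemma pow_eq_center_mult_pow:
  assumes "b \<in> carrier G" and "w \<in> center G" and "b [^] (m :: nat) = w \<otimes> b [^] (n :: nat)"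
  shows "m mod ord_mod_center G b = n mod ord_mod_center G b"
proof -
  interpret Q: group "G Mod center G"
    using normal.factorgroup_is_group[OF normal_center] .
  have "b [^] m \<in> center G #> b [^] n"
    using assms by (auto simp: r_coset_def)
  then have "center G #> b [^] n = center G #> b [^] m"
    using assms(1) by (intro repr_independence subgroup_center) auto
  then have "(center G #> b) [^]\<^bsub>G Mod center G\<^esub> m = (center G #> b) [^]\<^bsub>G Mod center G\<^esub> n"
    by (simp add: center_coset_pow assms(1))
  then show ?thesis
    using Q.pow_eq_iff_mod_ord[OF center_coset_closed[OF assms(1)]] by (simp add: ord_mod_center_def)
qed

text \<open>Put \<open>h = g'\<inverse> g\<close>. Then \<open>h x B = x B'\<close> for all \<open>x\<close>, and comparing with \<open>x = 1\<close> gives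
  \<open>h x B = x h B\<close>.\<close>

lemma central_ratio:
  assumes g: "g \<in> carrier G" "g' \<in> carrier G" and B: "B \<in> carrier G" "B' \<in> carrier G"
    and eq: "\<And>x. x \<in> carrier G \<Longrightarrow> g \<otimes> (x \<otimes> B) = g' \<otimes> (x \<otimes> B')"
  shows "inv g' \<otimes> g \<in> center G"
proof (rule centerI)
  let ?h = "inv g' \<otimes> g"
  have h: "?h \<otimes> (x \<otimes> B) = x \<otimes> B'" if "x \<in> carrier G" for x
  proof -
    have "?h \<otimes> (x \<otimes> B) = inv g' \<otimes> (g \<otimes> (x \<otimes> B))"
      using g B that by (simp add: m_assoc)
    also have "\<dots> = (inv g' \<otimes> g') \<otimes> (x \<otimes> B')"
      using g B that eq[OF that] m_assoc[of "inv g'" g' "x \<otimes> B'"] by simp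
    finally show ?thesis using g B that by simp
  qed
  have B'_eq: "?h \<otimes> B = B'"
    using h[OF one_closed] B by simp
  show "?h \<otimes> x = x \<otimes> ?h" if x: "x \<in> carrier G" for x
  proof -
    have "(?h \<otimes> x) \<otimes> B = (x \<otimes> ?h) \<otimes> B"
      using h[OF x] B'_eq x g B by (metis inv_closed m_assoc m_closed)
    then show ?thesis using g B x by simp
  qed
qed (use g in simp)

text \<open>The words \<open>b^e x\<^sub>1 b^d\<^sub>1 x\<^sub>2 b^d\<^sub>2 \<cdots>\<close> are compared from the left. Varying only the first
  variable shows that the parts before it differ by a central factor (\<open>central_ratio\<close>), so the
  exponents \<open>e\<close> and \<open>e'\<close> agree modulo the order; setting it to 1 and moving the central factor to
  the front leaves words that are shorter by one variable, with the next exponent in the role of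
  \<open>e\<close>.\<close>

lemma power_word_separation:
  assumes b: "b \<in> carrier G" and z: "z \<in> center G" "z' \<in> center G"
    and len: "length ds = length ds'"
    and eq: "\<And>xs. xs \<in> nlists (length ds) (carrier G) \<Longrightarrow>
      z \<otimes> (b [^] e \<otimes> list_prod G (map2 (\<lambda>d x. x \<otimes> b [^] d) ds xs)) =
      z' \<otimes> (b [^] e' \<otimes> list_prod G (map2 (\<lambda>d x. x \<otimes> b [^] d) ds' xs))"
  shows "map (\<lambda>d. d mod ord_mod_center G b) (e # ds) = map (\<lambda>d. d mod ord_mod_center G b) (e' # ds')"
  using len z eq
proof (induction ds ds' arbitrary: z z' e e' rule: list_induct2)
  case Nil
  have zc: "z \<in> carrier G" "z' \<in> carrier G" using Nil.prems by (simp_all add: center_closed)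
  have "z \<otimes> b [^] e = z' \<otimes> b [^] e'"
    using Nil.prems(3)[of "[]"] b by simp
  then have "b [^] e = (inv z \<otimes> z') \<otimes> b [^] e'"
    using zc b by (simp add: inv_solve_left m_assoc)
  from pow_eq_center_mult_pow[OF b _ this] Nil.prems(1,2) show ?case
    by (simp add: center_mult center_inv)
next
  case (Cons d ds d' ds')
  let ?P = "\<lambda>ds xs. list_prod G (map2 (\<lambda>d x. x \<otimes> b [^] d) ds xs)"
  have P: "?P ds xs \<in> carrier G" if "set xs \<subseteq> carrier G" for ds :: "nat list" and xs
    using that b by (intro list_prod_closed) (auto dest!: set_zip_rightD)
  let ?g = "z \<otimes> b [^] e" and ?g' = "z' \<otimes> b [^] e'"
  have zc: "z \<in> carrier G" "z' \<in> carrier G" using Cons.prems by (simp_all add: center_closed)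
  have eq: "?g \<otimes> (x \<otimes> (b [^] d \<otimes> ?P ds xs)) = ?g' \<otimes> (x \<otimes> (b [^] d' \<otimes> ?P ds' xs))"
    if "x \<in> carrier G" "xs \<in> nlists (length ds) (carrier G)" for x xs
    using Cons.prems(3)[of "x # xs"] that P[OF nlistsE_set[OF that(2)]] b zc by (simp add: m_assoc)
  define h where "h = inv ?g' \<otimes> ?g"
  have ones: "replicate (length ds) \<one> \<in> nlists (length ds) (carrier G)"
    by (simp add: nlists_replicateI)
  have h: "h \<in> center G"
    unfolding h_def by (rule central_ratio[OF _ _ _ _ eq[OF _ ones]])
      (use zc b P[OF nlistsE_set[OF ones]] in auto)
  have hc: "h \<in> carrier G" using h by (rule center_closed)
  have "?g' \<otimes> h = ?g"
    using zc b by (simp add: h_def inv_solve_left' flip: m_assoc)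
  then have g: "?g = h \<otimes> ?g'"
    using center_commute[OF h] zc b by simp
  have "b [^] e = (inv z \<otimes> (h \<otimes> z')) \<otimes> b [^] e'"
    using g zc hc b by (simp add: inv_solve_left m_assoc)
  from pow_eq_center_mult_pow[OF b _ this]
  have "e mod ord_mod_center G b = e' mod ord_mod_center G b"
    using h Cons.prems(1,2) by (simp add: center_mult center_inv)
  moreover have "map (\<lambda>d. d mod ord_mod_center G b) (d # ds) = map (\<lambda>d. d mod ord_mod_center G b) (d' # ds')"
  proof (rule Cons.IH[OF h center_one])
    fix xs assume xs: "xs \<in> nlists (length ds) (carrier G)"
    note Pc = P[OF nlistsE_set[OF xs]]
    have "?g' \<otimes> (h \<otimes> (b [^] d \<otimes> ?P ds xs)) = ?g \<otimes> (\<one> \<otimes> (b [^] d \<otimes> ?P ds xs))"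
      using g center_commute[OF h, of ?g'] zc hc b Pc by (simp flip: m_assoc)
    also have "\<dots> = ?g' \<otimes> (\<one> \<otimes> (b [^] d' \<otimes> ?P ds' xs))"
      by (rule eq[OF one_closed xs])
    finally show "h \<otimes> (b [^] d \<otimes> ?P ds xs) = \<one> \<otimes> (b [^] d' \<otimes> ?P ds' xs)"
      using zc hc b Pc by simp
  qed
  ultimately show ?case by simp
qed

text \<open>Shifting brackets: a product of terms \<open>b\<^sup>d x\<close> is a word of the kind treated by
  \<open>power_word_separation\<close>, whose last exponent is 0.\<close>

lemma list_prod_left_powers:
  assumes "b \<in> carrier G"
  shows "xs \<in> nlists (Suc (length ds)) (carrier G) \<Longrightarrow>
    list_prod G (map2 (\<lambda>d x. b [^] d \<otimes> x) (e # ds) xs) =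
    b [^] e \<otimes> list_prod G (map2 (\<lambda>d x. x \<otimes> b [^] d) (ds @ [0 :: nat]) xs)"
proof (induction ds arbitrary: e xs)
  case Nil
  then show ?case using assms by (auto simp: in_nlists_Suc_iff)
next
  case (Cons d ds)
  then obtain x ys where xs: "xs = x # ys" "x \<in> carrier G" "ys \<in> nlists (Suc (length ds)) (carrier G)"
    by (auto simp: in_nlists_Suc_iff)
  have "set (map2 (\<lambda>d x. x \<otimes> b [^] d) (ds @ [0 :: nat]) ys) \<subseteq> carrier G"
    using nlistsE_set[OF xs(3)] assms by (auto dest!: set_zip_rightD)
  from list_prod_closed[OF this] show ?case
    using Cons.IH[OF xs(3), of d] xs(1,2) assms by (simp add: m_assoc)
qed

section \<open>The three twisted products\<close>

lemma map2_replicate_neutral: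
  "(\<And>x. x \<in> set xs \<Longrightarrow> f e x = x) \<Longrightarrow> length xs = n \<Longrightarrow> map2 f (replicate n e) xs = xs"
  by (induction n arbitrary: xs) (auto simp: length_Suc_conv)

text \<open>Here \<open>a\<^sup>d (a x\<^sub>1 x\<^sub>2 \<cdots> x\<^sub>r) = (a\<^sup>d\<^sup>+\<^sup>1 x\<^sub>1) x\<^sub>2 \<cdots> x\<^sub>r\<close>: only the first child is marked.\<close>

lemma left_twisted_product:
  assumes "r \<ge> 2" and a: "a \<in> carrier G"
    and \<omega>: "\<And>xs. xs \<in> nlists r (carrier G) \<Longrightarrow> \<omega> xs = a \<otimes> list_prod G xs"
  shows "twisted_product G r \<omega> (True # replicate (r - 1) False) (\<lambda>d x. a [^] d \<otimes> x) (ord_mod_center G a)"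
proof unfold_locales
  let ?\<phi> = "\<lambda>(d :: nat) x. a [^] d \<otimes> x" and ?\<mu> = "True # replicate (r - 1) False"
  show "\<omega> xs \<in> carrier G" if "xs \<in> nlists r (carrier G)" for xs
    using \<omega>[OF that] a list_prod_nlists_closed[OF that] by simp
  show "\<exists>z\<in>center G. \<forall>xs\<in>nlists r (carrier G).
      ?\<phi> d (\<omega> xs) = z \<otimes> list_prod G (map2 ?\<phi> (map (\<lambda>m. if m then Suc d else 0) ?\<mu>) xs)" for d
  proof (rule bexI[OF _ center_one], rule ballI)
    fix xs assume len: "xs \<in> nlists r (carrier G)"
    obtain x ys where xs: "xs = x # ys" "x \<in> carrier G" "ys \<in> nlists (r - 1) (carrier G)"
      using len \<open>r \<ge> 2\<close> by (cases r) (auto simp: in_nlists_Suc_iff)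
    have ys: "map2 ?\<phi> (replicate (r - 1) 0) ys = ys"
      using nlistsE_set[OF xs(3)] nlistsE_length[OF xs(3)]
      by (intro map2_replicate_neutral) auto
    show "?\<phi> d (\<omega> xs) = \<one> \<otimes> list_prod G (map2 ?\<phi> (map (\<lambda>m. if m then Suc d else 0) ?\<mu>) xs)"
      using \<omega>[OF len] ys xs(1,2) a list_prod_nlists_closed[OF xs(3)] by (simp add: m_assoc)
  qed
  show "\<exists>c\<in>center G. \<forall>x\<in>carrier G. ?\<phi> (ord_mod_center G a) x = c \<otimes> x"
    using pow_ord_mod_center[OF a] by blast
  show "map (\<lambda>d. d mod ord_mod_center G a) ds = map (\<lambda>d. d mod ord_mod_center G a) ds'"
    if z: "z \<in> center G" "z' \<in> center G" and len: "length ds = length ds'"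
      and eq: "\<And>xs. xs \<in> nlists (length ds) (carrier G) \<Longrightarrow>
        z \<otimes> list_prod G (map2 ?\<phi> ds xs) = z' \<otimes> list_prod G (map2 ?\<phi> ds' xs)" for z z' ds ds'
  proof (cases ds)
    case Nil
    then show ?thesis using len by simp
  next
    case (Cons e es)
    then obtain e' es' where ds': "ds' = e' # es'" "length es = length es'"
      using len by (cases ds') auto
    have "map (\<lambda>d. d mod ord_mod_center G a) (e # es @ [0]) = map (\<lambda>d. d mod ord_mod_center G a) (e' # es' @ [0])"
    proof (rule power_word_separation[OF a z])
      fix xs assume "xs \<in> nlists (length (es @ [0])) (carrier G)"
      then have xs: "xs \<in> nlists (Suc (length es)) (carrier G)" "xs \<in> nlists (Suc (length es')) (carrier G)"
        using ds'(2) by simp_all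
      show "z \<otimes> (a [^] e \<otimes> list_prod G (map2 (\<lambda>d x. x \<otimes> a [^] d) (es @ [0]) xs)) =
          z' \<otimes> (a [^] e' \<otimes> list_prod G (map2 (\<lambda>d x. x \<otimes> a [^] d) (es' @ [0]) xs))"
        using eq[of xs] xs(1) Cons ds'(1)
        unfolding list_prod_left_powers[OF a xs(1), symmetric] list_prod_left_powers[OF a xs(2), symmetric]
        by simp
    qed (simp add: ds'(2))
    then show ?thesis using Cons ds'(1) by simp
  qed
qed (use assms in auto)

text \<open>Here \<open>x\<^sub>1 \<cdots> x\<^sub>r b \<cdot> b\<^sup>d = x\<^sub>1 \<cdots> (x\<^sub>r b\<^sup>d\<^sup>+\<^sup>1)\<close>: only the last child is marked.\<close>

lemma right_twisted_product:
  assumes "r \<ge> 2" and b: "b \<in> carrier G"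
    and \<omega>: "\<And>xs. xs \<in> nlists r (carrier G) \<Longrightarrow> \<omega> xs = list_prod G xs \<otimes> b"
  shows "twisted_product G r \<omega> (replicate (r - 1) False @ [True]) (\<lambda>d x. x \<otimes> b [^] d) (ord_mod_center G b)"
proof unfold_locales
  let ?\<phi> = "\<lambda>(d :: nat) x. x \<otimes> b [^] d" and ?\<mu> = "replicate (r - 1) False @ [True]"
  show "\<omega> xs \<in> carrier G" if "xs \<in> nlists r (carrier G)" for xs
    using \<omega>[OF that] b list_prod_nlists_closed[OF that] by simp
  show "\<exists>z\<in>center G. \<forall>xs\<in>nlists r (carrier G).
      ?\<phi> d (\<omega> xs) = z \<otimes> list_prod G (map2 ?\<phi> (map (\<lambda>m. if m then Suc d else 0) ?\<mu>) xs)" for d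
  proof (rule bexI[OF _ center_one], rule ballI)
    fix xs assume len: "xs \<in> nlists r (carrier G)"
    then have "xs \<noteq> []" using \<open>r \<ge> 2\<close> nlistsE_length[OF len] by auto
    then obtain ys x where "xs = ys @ [x]" by (metis rev_exhaust)
    with len \<open>r \<ge> 2\<close> have xs: "xs = ys @ [x]" "x \<in> carrier G" "ys \<in> nlists (r - 1) (carrier G)"
      by (auto simp: nlists_def)
    have ys: "map2 ?\<phi> (replicate (r - 1) 0) ys = ys"
      using nlistsE_set[OF xs(3)] nlistsE_length[OF xs(3)]
      by (intro map2_replicate_neutral) auto
    have "list_prod G (map2 ?\<phi> (map (\<lambda>m. if m then Suc d else 0) ?\<mu>) xs) =
        list_prod G (map2 ?\<phi> (replicate (r - 1) 0) ys @ [x \<otimes> b [^] Suc d])"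
      using xs(1) nlistsE_length[OF xs(3)] by simp
    also have "\<dots> = list_prod G ys \<otimes> (x \<otimes> b [^] Suc d)"
      unfolding ys using nlistsE_set[OF xs(3)] xs(2) b by (subst list_prod_append) auto
    finally show "?\<phi> d (\<omega> xs) = \<one> \<otimes> list_prod G (map2 ?\<phi> (map (\<lambda>m. if m then Suc d else 0) ?\<mu>) xs)"
      using \<omega>[OF len] xs(1,2) b list_prod_nlists_closed[OF xs(3)] nlistsE_set[OF xs(3)]
        nat_pow_Suc2[OF b, of d]
      by (simp add: m_assoc list_prod_append del: nat_pow_Suc)
  qed
  show "\<exists>c\<in>center G. \<forall>x\<in>carrier G. ?\<phi> (ord_mod_center G b) x = c \<otimes> x"
    using pow_ord_mod_center[OF b] center_commute by metis
  show "map (\<lambda>d. d mod ord_mod_center G b) ds = map (\<lambda>d. d mod ord_mod_center G b) ds'"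
    if z: "z \<in> center G" "z' \<in> center G" and len: "length ds = length ds'"
      and eq: "\<And>xs. xs \<in> nlists (length ds) (carrier G) \<Longrightarrow>
        z \<otimes> list_prod G (map2 ?\<phi> ds xs) = z' \<otimes> list_prod G (map2 ?\<phi> ds' xs)" for z z' ds ds'
  proof -
    have closed: "list_prod G (map2 ?\<phi> es xs) \<in> carrier G"
      if "xs \<in> nlists n (carrier G)" for es xs n
      using nlistsE_set[OF that] b by (intro list_prod_closed) (auto dest!: set_zip_rightD)
    \<comment> \<open>The words of this case have no power of b in front, hence the additional exponent 0 on both sides.\<close>
    have "map (\<lambda>d. d mod ord_mod_center G b) (0 # ds) = map (\<lambda>d. d mod ord_mod_center G b) (0 # ds')"
    proof (rule power_word_separation[OF b z len])
      fix xs assume xs: "xs \<in> nlists (length ds) (carrier G)"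
      show "z \<otimes> (b [^] (0::nat) \<otimes> list_prod G (map2 ?\<phi> ds xs)) =
          z' \<otimes> (b [^] (0::nat) \<otimes> list_prod G (map2 ?\<phi> ds' xs))"
        using eq[OF xs] closed[OF xs] by simp
    qed
    then show ?thesis by simp
  qed
qed (use assms in auto)

abbreviation aut_pow :: "('a \<Rightarrow> 'a) \<Rightarrow> nat \<Rightarrow> 'a \<Rightarrow> 'a" where
  "aut_pow \<psi> d \<equiv> \<psi> [^]\<^bsub>AutoGroup G\<^esub> d"

lemma aut_pow_hom: "\<psi> \<in> carrier (AutoGroup G) \<Longrightarrow> aut_pow \<psi> d \<in> hom G G"
  using monoid.nat_pow_closed[OF group.is_monoid[OF AutoGroup], of \<psi> d]
  by (simp add: AutoGroup_def auto_def)

lemma aut_pow_0: "x \<in> carrier G \<Longrightarrow> aut_pow \<psi> 0 x = x"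
  using monoid.nat_pow_0[OF group.is_monoid[OF AutoGroup], of \<psi>]
  by (simp add: AutoGroup_def BijGroup_def)

lemma aut_pow_Suc:
  assumes "\<psi> \<in> carrier (AutoGroup G)" and "x \<in> carrier G"
  shows "aut_pow \<psi> (Suc d) x = aut_pow \<psi> d (\<psi> x)"
proof -
  have "aut_pow \<psi> d \<in> carrier (AutoGroup G)"
    using monoid.nat_pow_closed[OF group.is_monoid[OF AutoGroup] assms(1)] .
  then have "aut_pow \<psi> d \<in> Bij (carrier G)" "\<psi> \<in> Bij (carrier G)"
    using assms(1) by (auto simp: AutoGroup_def auto_def)
  then have "aut_pow \<psi> d \<otimes>\<^bsub>AutoGroup G\<^esub> \<psi> = compose (carrier G) (aut_pow \<psi> d) \<psi>"
    by (simp only: AutoGroup_def BijGroup_def monoid.simps partial_object.simps restrict_apply if_True)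
  then show ?thesis
    using monoid.nat_pow_Suc[OF group.is_monoid[OF AutoGroup], of \<psi> d] assms(2)
    by (simp only: compose_eq)
qed

lemma aut_pow_eq_imp_mod:
  assumes \<psi>: "\<psi> \<in> carrier (AutoGroup G)"
    and eq: "\<And>x. x \<in> carrier G \<Longrightarrow> aut_pow \<psi> m x = aut_pow \<psi> n x"
  shows "m mod group.ord (AutoGroup G) \<psi> = n mod group.ord (AutoGroup G) \<psi>"
proof -
  have "aut_pow \<psi> d \<in> extensional (carrier G)" for d
    using monoid.nat_pow_closed[OF group.is_monoid[OF AutoGroup] \<psi>, of d]
    by (auto simp: AutoGroup_def auto_def Bij_def)
  then have "aut_pow \<psi> m = aut_pow \<psi> n"
    using eq by (intro extensionalityI)
  then show ?thesis
    using group.pow_eq_iff_mod_ord[OF AutoGroup \<psi>] by blast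
qed

lemma hom_list_prod:
  assumes "f \<in> hom G G"
  shows "set xs \<subseteq> carrier G \<Longrightarrow> f (list_prod G xs) = list_prod G (map f xs)"
  by (induction xs) (auto simp: hom_mult[OF assms] hom_one[OF assms is_group is_group])

lemma aut_pow_center:
  assumes \<psi>: "\<psi> \<in> carrier (AutoGroup G)" and d: "z \<in> center G"
  shows "aut_pow \<psi> d z \<in> center G"
proof -
  have "aut_pow \<psi> d \<in> carrier (AutoGroup G)"
    using monoid.nat_pow_closed[OF group.is_monoid[OF AutoGroup] \<psi>] .
  then have f: "aut_pow \<psi> d \<in> hom G G" "aut_pow \<psi> d ` carrier G = carrier G"
    by (auto simp: AutoGroup_def auto_def Bij_def bij_betw_def)
  show ?thesis
  proof (rule centerI)
    show "aut_pow \<psi> d z \<in> carrier G"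
      using f(1) center_closed[OF d] by (rule hom_in_carrier)
    fix g assume "g \<in> carrier G"
    then obtain x where x: "x \<in> carrier G" "g = aut_pow \<psi> d x" using f(2) by (metis imageE)
    then show "aut_pow \<psi> d z \<otimes> g = g \<otimes> aut_pow \<psi> d z"
      using center_commute[OF d x(1)] hom_mult[OF f(1)] center_closed[OF d] by metis
  qed
qed

text \<open>Automorphisms fix 1, so a tuple with a single entry different from 1 isolates one exponent,
  and the tuple of ones shows that \<open>z\<close> and \<open>z'\<close> are equal.\<close>

lemma aut_word_separation:
  assumes \<psi>: "\<psi> \<in> carrier (AutoGroup G)" and z: "z \<in> carrier G" "z' \<in> carrier G"
    and len: "length ds = length ds'"
    and eq: "\<And>xs. xs \<in> nlists (length ds) (carrier G) \<Longrightarrow>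
      z \<otimes> list_prod G (map2 (aut_pow \<psi>) ds xs) = z' \<otimes> list_prod G (map2 (aut_pow \<psi>) ds' xs)"
  shows "map (\<lambda>d. d mod group.ord (AutoGroup G) \<psi>) ds = map (\<lambda>d. d mod group.ord (AutoGroup G) \<psi>) ds'"
  using len eq
proof (induction ds ds' rule: list_induct2)
  case (Cons d ds d' ds')
  let ?P = "\<lambda>ds xs. list_prod G (map2 (aut_pow \<psi>) ds xs)"
  have one: "aut_pow \<psi> d \<one> = \<one>" for d
    using hom_one[OF aut_pow_hom[OF \<psi>] is_group is_group] .
  have closed: "aut_pow \<psi> d x \<in> carrier G" if "x \<in> carrier G" for d x
    using hom_in_carrier[OF aut_pow_hom[OF \<psi>] that] .
  have P_ones: "?P es (replicate n \<one>) = \<one>" for es n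
  proof (induction es arbitrary: n)
    case (Cons e es)
    then show ?case by (cases n) (auto simp: one)
  qed simp
  let ?ones = "replicate (length ds) \<one>"
  have ones: "?ones \<in> nlists (length ds) (carrier G)"
    by (simp add: nlists_replicateI)
  have eq_x: "z \<otimes> aut_pow \<psi> d x = z' \<otimes> aut_pow \<psi> d' x" if "x \<in> carrier G" for x
    using Cons.prems[of "x # ?ones"] ones that closed P_ones by simp
  have zz': "z = z'"
    using eq_x[OF one_closed] z by (simp add: one)
  have "d mod group.ord (AutoGroup G) \<psi> = d' mod group.ord (AutoGroup G) \<psi>"
    by (rule aut_pow_eq_imp_mod[OF \<psi>]) (use eq_x zz' z closed in simp)
  moreover have "z \<otimes> ?P ds xs = z' \<otimes> ?P ds' xs" if xs: "xs \<in> nlists (length ds) (carrier G)" for xs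
  proof -
    have "set (map2 (aut_pow \<psi>) es xs) \<subseteq> carrier G" for es
      using nlistsE_set[OF xs] closed by (auto dest!: set_zip_rightD)
    then show ?thesis
      using Cons.prems[of "\<one> # xs"] xs one by simp
  qed
  ultimately show ?case using Cons.IH by simp
qed simp

text \<open>Here \<open>\<psi>\<^sup>d (d\<^sub>0 \<psi> (x\<^sub>1 \<cdots> x\<^sub>r)) = \<psi>\<^sup>d d\<^sub>0 \<cdot> \<psi>\<^sup>d\<^sup>+\<^sup>1 x\<^sub>1 \<cdots> \<psi>\<^sup>d\<^sup>+\<^sup>1 x\<^sub>r\<close>: all children are marked, and \<open>\<psi>\<^sup>d d\<^sub>0\<close>
  is central.\<close>

lemma automorphism_twisted_product:
  assumes "r \<ge> 2" and d0: "d0 \<in> center G" and \<psi>: "\<psi> \<in> carrier (AutoGroup G)"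
    and \<omega>: "\<And>xs. xs \<in> nlists r (carrier G) \<Longrightarrow> \<omega> xs = d0 \<otimes> \<psi> (list_prod G xs)"
  shows "twisted_product G r \<omega> (replicate r True) (aut_pow \<psi>) (group.ord (AutoGroup G) \<psi>)"
proof unfold_locales
  have closed: "aut_pow \<psi> d x \<in> carrier G" if "x \<in> carrier G" for d x
    using hom_in_carrier[OF aut_pow_hom[OF \<psi>] that] .
  then show "aut_pow \<psi> d x \<in> carrier G" if "x \<in> carrier G" for d x
    using that .
  have \<psi>_closed: "\<psi> x \<in> carrier G" if "x \<in> carrier G" for x
    using aut_pow_Suc[OF \<psi> that, of 0] closed[OF that, of "Suc 0"] \<psi> that
    by (auto simp: AutoGroup_def auto_def Bij_def bij_betw_def)
  show "\<omega> xs \<in> carrier G" if "xs \<in> nlists r (carrier G)" for xs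
    using \<omega>[OF that] center_closed[OF d0] \<psi>_closed[OF list_prod_nlists_closed[OF that]] by simp
  show "\<exists>z\<in>center G. \<forall>xs\<in>nlists r (carrier G). aut_pow \<psi> d (\<omega> xs) =
      z \<otimes> list_prod G (map2 (aut_pow \<psi>) (map (\<lambda>m. if m then Suc d else 0) (replicate r True)) xs)" for d
  proof (rule bexI[OF _ aut_pow_center[OF \<psi> d0, of d]], rule ballI)
    fix xs assume xs: "xs \<in> nlists r (carrier G)"
    have prod: "list_prod G xs \<in> carrier G" using list_prod_nlists_closed[OF xs] .
    have "map2 (aut_pow \<psi>) (replicate (length ys) (Suc d)) ys = map (aut_pow \<psi> (Suc d)) ys" for ys
      by (induction ys) auto
    from this[of xs] have map2: "map2 (aut_pow \<psi>) (replicate r (Suc d)) xs = map (aut_pow \<psi> (Suc d)) xs"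
      using nlistsE_length[OF xs] by simp
    have "aut_pow \<psi> d (\<omega> xs) = aut_pow \<psi> d d0 \<otimes> aut_pow \<psi> d (\<psi> (list_prod G xs))"
      using \<omega>[OF xs] hom_mult[OF aut_pow_hom[OF \<psi>] center_closed[OF d0] \<psi>_closed[OF prod]] by simp
    also have "\<dots> = aut_pow \<psi> d d0 \<otimes> list_prod G (map (aut_pow \<psi> (Suc d)) xs)"
      by (simp only: aut_pow_Suc[OF \<psi> prod, symmetric]
          hom_list_prod[OF aut_pow_hom[OF \<psi>] nlistsE_set[OF xs]])
    finally show "aut_pow \<psi> d (\<omega> xs) = aut_pow \<psi> d d0 \<otimes>
        list_prod G (map2 (aut_pow \<psi>) (map (\<lambda>m. if m then Suc d else 0) (replicate r True)) xs)"
      by (simp only: map_replicate if_True map2)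
  qed
  show "\<exists>c\<in>center G. \<forall>x\<in>carrier G. aut_pow \<psi> (group.ord (AutoGroup G) \<psi>) x = c \<otimes> x"
    using group.pow_ord_eq_1[OF AutoGroup \<psi>]
    by (intro bexI[of _ \<one>]) (auto simp: AutoGroup_def BijGroup_def)
  show "map (\<lambda>d. d mod group.ord (AutoGroup G) \<psi>) ds = map (\<lambda>d. d mod group.ord (AutoGroup G) \<psi>) ds'"
    if z: "z \<in> center G" "z' \<in> center G" and len: "length ds = length ds'"
      and eq: "\<And>xs. xs \<in> nlists (length ds) (carrier G) \<Longrightarrow>
        z \<otimes> list_prod G (map2 (aut_pow \<psi>) ds xs) = z' \<otimes> list_prod G (map2 (aut_pow \<psi>) ds' xs)" for z z' ds ds'
    using aut_word_separation[OF \<psi> center_closed[OF z(1)] center_closed[OF z(2)] len eq] .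
qed (use assms aut_pow_0 in auto)

end

theorem theorem5p10:
  fixes G :: "('a, 'b) monoid_scheme"
    and r :: nat
    and \<omega> :: "'a list \<Rightarrow> 'a"
  assumes "r \<ge> 2"
    and "group G"
    and "\<omega> \<in> nlists r (carrier G) \<rightarrow> carrier G"
  shows
    "(\<forall>c \<in> center G.
        (\<forall>xs \<in> nlists r (carrier G). \<omega> xs = c \<otimes>\<^bsub>G\<^esub> list_prod G xs) \<longrightarrow>
        Assoc r (carrier G) \<omega> = carrier (HT r))
     \<and>
     (\<forall>a \<in> carrier G - center G. \<forall>k.
        (\<forall>xs \<in> nlists r (carrier G). \<omega> xs = a \<otimes>\<^bsub>G\<^esub> list_prod G xs) \<and>
        k = ord_mod_center G a \<longrightarrow>
        (k \<noteq> 0 \<longrightarrow> Assoc r (carrier G) \<omega> = iota r (left_vine r k) ` carrier (HT (1 + k * (r - 1)))) \<and>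
        (k = 0 \<longrightarrow> Assoc r (carrier G) \<omega> = {\<one>\<^bsub>HT r\<^esub>}))
     \<and>
     (\<forall>b \<in> carrier G - center G. \<forall>k.
        (\<forall>xs \<in> nlists r (carrier G). \<omega> xs = list_prod G xs \<otimes>\<^bsub>G\<^esub> b) \<and>
        k = ord_mod_center G b \<longrightarrow>
        (k \<noteq> 0 \<longrightarrow> Assoc r (carrier G) \<omega> = iota r (right_vine r k) ` carrier (HT (1 + k * (r - 1)))) \<and>
        (k = 0 \<longrightarrow> Assoc r (carrier G) \<omega> = {\<one>\<^bsub>HT r\<^esub>}))
     \<and>
     (\<forall>d \<in> center G. \<forall>\<psi> \<in> carrier (AutoGroup G). \<forall>h.
        (\<forall>xs \<in> nlists r (carrier G). \<omega> xs = d \<otimes>\<^bsub>G\<^esub> \<psi> (list_prod G xs)) \<and>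
        h = group.ord (AutoGroup G) \<psi> \<longrightarrow>
        (h \<noteq> 0 \<longrightarrow> Assoc r (carrier G) \<omega> = iota r (perfect r h) ` carrier (HT (r ^ h))) \<and>
        (h = 0 \<longrightarrow> Assoc r (carrier G) \<omega> = {\<one>\<^bsub>HT r\<^esub>}))"
proof -
  interpret group G by fact
  have r: "r \<ge> 1" using \<open>r \<ge> 2\<close> by simp
  show ?thesis
  proof (intro conjI ballI allI impI; (elim conjE)?)
    fix c assume "c \<in> center G" "\<forall>xs\<in>nlists r (carrier G). \<omega> xs = c \<otimes>\<^bsub>G\<^esub> list_prod G xs"
    then show "Assoc r (carrier G) \<omega> = carrier (HT r)"
      using Assoc_central_product \<open>r \<ge> 2\<close> by blast
  next
    fix a k assume a: "a \<in> carrier G - center G" "k = ord_mod_center G a"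
      "\<forall>xs\<in>nlists r (carrier G). \<omega> xs = a \<otimes>\<^bsub>G\<^esub> list_prod G xs"
    then interpret twisted_product G r \<omega> "True # replicate (r - 1) False" "\<lambda>d x. a [^]\<^bsub>G\<^esub> d \<otimes>\<^bsub>G\<^esub> x" k
      using left_twisted_product[OF \<open>r \<ge> 2\<close>, of a \<omega>] by simp
    show "k \<noteq> 0 \<Longrightarrow> Assoc r (carrier G) \<omega> = iota r (left_vine r k) ` carrier (HT (1 + k * (r - 1)))"
      using Assoc_eq_iota_chain_tree
      unfolding left_vine_eq_chain_tree[OF r, symmetric] leaves_left_vine[OF r] .
    show "k = 0 \<Longrightarrow> Assoc r (carrier G) \<omega> = {\<one>\<^bsub>HT r\<^esub>}"
      by (rule Assoc_trivial)
  next
    fix b k assume b: "b \<in> carrier G - center G" "k = ord_mod_center G b"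
      "\<forall>xs\<in>nlists r (carrier G). \<omega> xs = list_prod G xs \<otimes>\<^bsub>G\<^esub> b"
    then interpret twisted_product G r \<omega> "replicate (r - 1) False @ [True]" "\<lambda>d x. x \<otimes>\<^bsub>G\<^esub> b [^]\<^bsub>G\<^esub> d" k
      using right_twisted_product[OF \<open>r \<ge> 2\<close>, of b \<omega>] by simp
    show "k \<noteq> 0 \<Longrightarrow> Assoc r (carrier G) \<omega> = iota r (right_vine r k) ` carrier (HT (1 + k * (r - 1)))"
      using Assoc_eq_iota_chain_tree
      unfolding right_vine_eq_chain_tree[OF r, symmetric] leaves_right_vine[OF r] .
    show "k = 0 \<Longrightarrow> Assoc r (carrier G) \<omega> = {\<one>\<^bsub>HT r\<^esub>}"
      by (rule Assoc_trivial)
  next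
    fix d \<psi> h assume d: "d \<in> center G" "\<psi> \<in> carrier (AutoGroup G)" "h = group.ord (AutoGroup G) \<psi>"
      "\<forall>xs\<in>nlists r (carrier G). \<omega> xs = d \<otimes>\<^bsub>G\<^esub> \<psi> (list_prod G xs)"
    then interpret twisted_product G r \<omega> "replicate r True" "\<lambda>d. \<psi> [^]\<^bsub>AutoGroup G\<^esub> d" h
      using automorphism_twisted_product[OF \<open>r \<ge> 2\<close>, of d \<psi> \<omega>] by simp
    show "h \<noteq> 0 \<Longrightarrow> Assoc r (carrier G) \<omega> = iota r (perfect r h) ` carrier (HT (r ^ h))"
      using Assoc_eq_iota_chain_tree
      unfolding perfect_eq_chain_tree[symmetric] leaves_perfect .
    show "h = 0 \<Longrightarrow> Assoc r (carrier G) \<omega> = {\<one>\<^bsub>HT r\<^esub>}"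
      by (rule Assoc_trivial)
  qed
qed

end
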